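(* Let $b\geq 2$ and $q\geq 3$ be integers, and let $T$ be the complete $b$-ary tree with $n$ vertices. Let $\mathcal{M}$ be the Metropolis Glauber dynamics for sampling proper $q$-colourings of $T$. Then for fixed $q$ and $b$ the mixing time $\tau(\mathcal{M},1/(2e))$ is $n^{O(b/\log b)}$, where the constant implicit in the $O()$ notation does not depend on $n$, $q$ or $b$. In particular, $$\tau(\mathcal{M},1/(2e)) \leq 3 b q^2 (1+\lg n)\, n^{3+\frac{3b}{\ln b}}.$$
   Context: The complete $b$-ary tree of height $H$ has a root, every non-leaf vertex has exactly $b$ children, and every root-to-leaf path has $H$ edges; it has $n=(b^{H+1}-1)/(b-1)$ vertices. A proper $q$-colouring is a map from the vertices to $[q]=\{0,\dots,q-1\}$ giving adjacent vertices different colours; $\Omega$ denotes the set of proper $q$-colourings of $T$. The Metropolis Glauber dynamics $\mathcal{M}$ is the Markov chain on $\Omega$ which, from the current colouring, chooses a vertex $v$ uniformly at random and a colour $c\in[q]$ uniformly at random, and recolours $v$ with $c$ if and only if the result is a proper colouring (otherwise it stays put). For $q\ge 3$ it converges to the uniform distribution $\pi$ on $\Omega$. With $P$ its transition matrix and $\|\theta_1-\theta_2\|=\max_{A\subseteq\Omega}|\theta_1(A)-\theta_2(A)|$ the total variation distance, $\tau_x(\mathcal{M},\delta)=\min\{t>0: \|P^{t'}(x,\cdot)-\pi\|\le\delta \text{ for all } t'\ge t\}$ and $\tau(\mathcal{M},\delta)=\max_{x\in\Omega}\tau_x(\mathcal{M},\delta)$. Here $\lg$ is the base-2 logarithm and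 $\ln$ the natural logarithm. *)

theory Defs
  imports "HOL-Probability.Probability"
begin

section \<open>Proper colourings of the complete b-ary tree\<close>

text \<open>A vertex is the list of child indices on its path from the root, most recent step
  first: the root is \<^term>\<open>[]\<close> and the children of \<^term>\<open>v\<close> are the lists \<^term>\<open>i # v\<close>.\<close>

definition tree_verts :: "nat \<Rightarrow> nat \<Rightarrow> nat list set" where
  "tree_verts b H = {v. set v \<subseteq> {..<b} \<and> length v \<le> H}"

definition tree_adj :: "nat list \<Rightarrow> nat list \<Rightarrow> bool" where
  "tree_adj u v \<longleftrightarrow> (\<exists>i. u = i # v \<or> v = i # u)"

lemma card_tree_verts:
  assumes "b \<ge> 2"
  shows "real (card (tree_verts b H)) = (real b ^ (H + 1) - 1) / (real b - 1)"
proof -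
  have "card (tree_verts b H) = (\<Sum>i\<le>H. b ^ i)"
    unfolding tree_verts_def by (simp add: card_lists_length_le)
  then have "real (card (tree_verts b H)) = (\<Sum>i<Suc H. real b ^ i)"
    by (simp add: lessThan_Suc_atMost)
  then show ?thesis
    using assms by (subst (asm) geometric_sum) auto
qed

text \<open>Colourings are extensional, i.e. \<^term>\<open>undefined\<close> outside \<^term>\<open>V\<close>, so that each map
  from \<^term>\<open>V\<close> to the colours is counted exactly once.\<close>

definition proper_colourings ::
    "'v set \<Rightarrow> ('v \<Rightarrow> 'v \<Rightarrow> bool) \<Rightarrow> nat \<Rightarrow> ('v \<Rightarrow> nat) set" where
  "proper_colourings V adj q =
     {x \<in> V \<rightarrow>\<^sub>E {..<q}. \<forall>u\<in>V. \<forall>v\<in>V. adj u v \<longrightarrow> x u \<noteq> x v}"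


section \<open>Markov chains, total variation distance and mixing time\<close>

text \<open>A chain is given by its transition kernel: \<^term>\<open>pmf (K x) y\<close> is the \<open>(x, y)\<close> entry of the
  transition matrix \<open>P\<close>, and \<open>chain_dist K t x\<close> is the row \<open>P\<^sup>t(x, \<cdot>)\<close>.\<close>

fun chain_dist :: "('s \<Rightarrow> 's pmf) \<Rightarrow> nat \<Rightarrow> 's \<Rightarrow> 's pmf" where
  "chain_dist K 0 x = return_pmf x"
| "chain_dist K (Suc t) x = bind_pmf (chain_dist K t x) K"

definition tv_dist :: "'s set \<Rightarrow> 's pmf \<Rightarrow> 's pmf \<Rightarrow> real" where
  "tv_dist \<Omega> \<theta>1 \<theta>2 =
     Max ((\<lambda>A. \<bar>measure_pmf.prob \<theta>1 A - measure_pmf.prob \<theta>2 A\<bar>) ` Pow \<Omega>)"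

text \<open>The value is an extended natural number, so that it is infinite (rather than \<open>0\<close>)
  if the set of admissible times is empty.\<close>

definition mixing_time_from ::
    "('s \<Rightarrow> 's pmf) \<Rightarrow> 's set \<Rightarrow> 's pmf \<Rightarrow> real \<Rightarrow> 's \<Rightarrow> enat" where
  "mixing_time_from K \<Omega> \<pi> \<delta> x =
     Inf (enat ` {t. t > 0 \<and> (\<forall>t'\<ge>t. tv_dist \<Omega> (chain_dist K t' x) \<pi> \<le> \<delta>)})"

definition mixing_time ::
    "('s \<Rightarrow> 's pmf) \<Rightarrow> 's set \<Rightarrow> 's pmf \<Rightarrow> real \<Rightarrow> enat" where
  "mixing_time K \<Omega> \<pi> \<delta> = Max (mixing_time_from K \<Omega> \<pi> \<delta> ` \<Omega>)"


section \<open>Metropolis Glauber dynamics\<close>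

definition metropolis_step ::
    "'v set \<Rightarrow> ('v \<Rightarrow> 'v \<Rightarrow> bool) \<Rightarrow> nat \<Rightarrow> ('v \<Rightarrow> nat) \<Rightarrow> ('v \<Rightarrow> nat) pmf" where
  "metropolis_step V adj q x =
     bind_pmf (pmf_of_set V) (\<lambda>v.
     bind_pmf (pmf_of_set {..<q}) (\<lambda>c.
     return_pmf (if x(v := c) \<in> proper_colourings V adj q then x(v := c) else x)))"

definition tree_mixing_time :: "nat \<Rightarrow> nat \<Rightarrow> nat \<Rightarrow> real \<Rightarrow> enat" where
  "tree_mixing_time b q H \<delta> =
     (let V = tree_verts b H; \<Omega> = proper_colourings V tree_adj q
      in mixing_time (metropolis_step V tree_adj q) \<Omega> (pmf_of_set \<Omega>) \<delta>)"

end

theory Submission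
  imports Defs
begin

text \<open>The heart of the matter is a Poincare inequality for uniform colourings of a tree whose
  root is restricted to a list of at least \<open>q - 1\<close> colours, with a constant that grows by the factor
  \<open>1 + 3 * 2^b\<close> per level. Given the root colour \<open>a\<close>, the \<open>b\<close> subtrees are independent and each of
  them has its own root restricted to the \<open>q - 1\<close> colours other than \<open>a\<close>, so the conditional
  variance tensorises. The conditional means for two root colours \<open>a\<close> and \<open>a'\<close> are compared on the
  event that no child of the root has colour \<open>a\<close> or \<open>a'\<close>: there the root can be recoloured
  directly, and the event has probability \<open>((q - 2) / (q - 1))^b \<ge> 2^-b\<close>. Finally the Metropolis
  chain is positive semidefinite, so its spectral gap alone controls the decay of the variance, and
  \<open>(1 + 3 * 2^b)^H \<le> exp (3 * b * H) \<le> n powr (3 * b / ln b)\<close>.\<close>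

section \<open>Sums of squared deviations\<close>

text \<open>This is \<open>card A\<close> times the variance of \<open>f\<close> under the uniform distribution on \<open>A\<close>.\<close>

definition ssq :: "'a set \<Rightarrow> ('a \<Rightarrow> real) \<Rightarrow> real" where
  "ssq A f = (\<Sum>x\<in>A. (f x)\<^sup>2) - (\<Sum>x\<in>A. f x)\<^sup>2 / real (card A)"

lemma sum_diff_const_squared:
  fixes f :: "'a \<Rightarrow> real"
  assumes "finite A"
  shows "(\<Sum>x\<in>A. (f x - c)\<^sup>2) = (\<Sum>x\<in>A. (f x)\<^sup>2) - 2 * c * (\<Sum>x\<in>A. f x) + real (card A) * c\<^sup>2"
proof -
  have "(f x - c)\<^sup>2 = (f x)\<^sup>2 - 2 * c * f x + c\<^sup>2" for x
    by (simp add: power2_diff)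
  then show ?thesis
    by (simp only: sum.distrib sum_subtractf sum_distrib_left[symmetric] sum_constant)
qed

text \<open>The squared error about an arbitrary centre \<open>c\<close> splits into the spread
  about the mean and the squared bias. For empty \<open>A\<close> both sides are 0.\<close>

lemma sum_diff_const_eq_ssq:
  assumes "finite A"
  shows "(\<Sum>x\<in>A. (f x - c)\<^sup>2) = ssq A f + real (card A) * (c - (\<Sum>x\<in>A. f x) / real (card A))\<^sup>2"
proof (cases "A = {}")
  case False
  then have "real (card A) > 0" using assms by (simp add: card_gt_0_iff)
  then show ?thesis
    unfolding sum_diff_const_squared[OF assms] ssq_def
    by (simp add: field_simps power2_eq_square)
qed (simp add: ssq_def)

lemma ssq_le_sum_diff_const: "finite A \<Longrightarrow> ssq A f \<le> (\<Sum>x\<in>A. (f x - c)\<^sup>2)"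
  by (simp add: sum_diff_const_eq_ssq)

lemma ssq_eq_mean:
  "finite A \<Longrightarrow> ssq A f = (\<Sum>x\<in>A. (f x - (\<Sum>x\<in>A. f x) / real (card A))\<^sup>2)"
  by (simp add: sum_diff_const_eq_ssq)

lemma ssq_nonneg: "finite A \<Longrightarrow> ssq A f \<ge> 0"
  by (simp add: ssq_eq_mean sum_nonneg)

lemma ssq_diff_const:
  assumes "finite A"
  shows "ssq A (\<lambda>x. f x - c) = ssq A f"
proof (cases "A = {}")
  case False
  then have "real (card A) > 0" using assms by (simp add: card_gt_0_iff)
  then show ?thesis
    unfolding ssq_def sum_diff_const_squared[OF assms]
    by (simp add: sum_subtractf field_simps power2_eq_square)
qed (simp add: ssq_def)

lemma mean_squared_le:
  fixes f :: "'a \<Rightarrow> real"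
  assumes "finite A"
  shows "((\<Sum>x\<in>A. f x) / real (card A))\<^sup>2 \<le> (\<Sum>x\<in>A. (f x)\<^sup>2) / real (card A)"
proof (cases "A = {}")
  case False
  then have "real (card A) > 0" using assms by (simp add: card_gt_0_iff)
  moreover have "(\<Sum>x\<in>A. f x)\<^sup>2 / real (card A) \<le> (\<Sum>x\<in>A. (f x)\<^sup>2)"
    using ssq_nonneg[OF assms, of f] by (simp add: ssq_def)
  ultimately show ?thesis
    by (simp add: field_simps power2_eq_square)
qed simp

text \<open>Writing the variance over ordered pairs lets a bound on pairwise differences of
  conditional means be summed into a bound on their \<open>ssq\<close>.\<close>

lemma sum_pairs_eq_ssq:
  assumes "finite A"
  shows "(\<Sum>x\<in>A. \<Sum>y\<in>A. (f x - f y)\<^sup>2) = 2 * real (card A) * ssq A f"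
proof (cases "A = {}")
  case False
  then have pos: "real (card A) > 0" using assms by (simp add: card_gt_0_iff)
  have "(f x - f y)\<^sup>2 = (f x)\<^sup>2 - 2 * (f x * f y) + (f y)\<^sup>2" for x y
    by (simp add: power2_diff)
  then have "(\<Sum>x\<in>A. \<Sum>y\<in>A. (f x - f y)\<^sup>2) = real (card A) * (\<Sum>x\<in>A. (f x)\<^sup>2)
      - 2 * ((\<Sum>x\<in>A. f x) * (\<Sum>x\<in>A. f x)) + real (card A) * (\<Sum>x\<in>A. (f x)\<^sup>2)"
    by (simp only: sum.distrib sum_subtractf sum_distrib_left[symmetric] sum_distrib_right[symmetric]
        sum_constant)
  with pos show ?thesis
    by (simp add: ssq_def right_diff_distrib power2_eq_square)
qed simp

lemma ssq_reindex: "inj_on h A \<Longrightarrow> ssq (h ` A) f = ssq A (\<lambda>x. f (h x))"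
  by (simp add: ssq_def sum.reindex card_image)

text \<open>Two-factor Efron-Stein inequality. The variance is the sum of row effect, column effect
  and interaction; the right-hand side counts the interaction twice, and the interaction is a sum of
  squares.\<close>

lemma ssq_Times_le:
  assumes "finite A" "finite B"
  shows "ssq (A \<times> B) (\<lambda>(a, b). f a b)
    \<le> (\<Sum>b\<in>B. ssq A (\<lambda>a. f a b)) + (\<Sum>a\<in>A. ssq B (f a))"
proof (cases "A = {} \<or> B = {}")
  case False
  define m n where "m = real (card A)" and "n = real (card B)"
  have pos: "m > 0" "n > 0" using assms False by (auto simp: m_def n_def card_gt_0_iff)
  define R where "R a = (\<Sum>b\<in>B. f a b)" for a
  define S where "S b = (\<Sum>a\<in>A. f a b)" for b
  define T where "T = (\<Sum>a\<in>A. R a)"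
  have T: "T = (\<Sum>b\<in>B. S b)" unfolding T_def R_def S_def by (rule sum.swap)
  define Q where "Q = (\<Sum>a\<in>A. \<Sum>b\<in>B. (f a b)\<^sup>2)"
  have Q: "Q = (\<Sum>b\<in>B. \<Sum>a\<in>A. (f a b)\<^sup>2)" unfolding Q_def by (rule sum.swap)
  have sums: "(\<Sum>a\<in>A. \<Sum>b\<in>B. f a b * S b) = (\<Sum>b\<in>B. (S b)\<^sup>2)"
    by (subst sum.swap) (simp add: S_def power2_eq_square sum_distrib_right)
  \<comment> \<open>The summand is the interaction: \<open>f a b\<close> without its row mean and
    its column mean, with the grand mean restored.\<close>
  have "0 \<le> (\<Sum>a\<in>A. \<Sum>b\<in>B. ((f a b - R a / n) - (S b / m - T / (m * n)))\<^sup>2)"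
    by (intro sum_nonneg) auto
  also have "\<dots> = (\<Sum>a\<in>A. \<Sum>b\<in>B. (f a b)\<^sup>2 - 2 / n * (f a b * R a) + (R a)\<^sup>2 / n\<^sup>2
        - 2 / m * (f a b * S b) + 2 * T / (m * n) * f a b + 2 / (m * n) * (R a * S b)
        - 2 * T / (m * n\<^sup>2) * R a + (S b)\<^sup>2 / m\<^sup>2 - 2 * T / (m\<^sup>2 * n) * S b + T\<^sup>2 / (m * n)\<^sup>2)"
    by (intro sum.cong refl) (use pos in \<open>simp add: power2_eq_square field_simps\<close>)
  also have "\<dots> = Q - 2 / n * (\<Sum>a\<in>A. (R a)\<^sup>2) + n * (\<Sum>a\<in>A. (R a)\<^sup>2) / n\<^sup>2
        - 2 / m * (\<Sum>b\<in>B. (S b)\<^sup>2) + 2 * T / (m * n) * T + 2 / (m * n) * (T * T)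
        - n * (2 * T / (m * n\<^sup>2) * T) + m * ((\<Sum>b\<in>B. (S b)\<^sup>2) / m\<^sup>2)
        - m * (2 * T / (m\<^sup>2 * n) * T) + m * n * T\<^sup>2 / (m * n)\<^sup>2"
    by (simp add: sum.distrib sum_subtractf sum_distrib_left[symmetric] sum_distrib_right[symmetric]
        sum_divide_distrib[symmetric] sums Q_def R_def[symmetric] T_def[symmetric] T[symmetric]
        m_def[symmetric] n_def[symmetric] power2_eq_square[of "R _"])
  also have "\<dots> = Q - (\<Sum>a\<in>A. (R a)\<^sup>2) / n - (\<Sum>b\<in>B. (S b)\<^sup>2) / m + T\<^sup>2 / (m * n)"
    using pos by (simp add: field_simps power2_eq_square)
  finally have "Q - T\<^sup>2 / (m * n) \<le> (Q - (\<Sum>b\<in>B. (S b)\<^sup>2) / m) + (Q - (\<Sum>a\<in>A. (R a)\<^sup>2) / n)"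
    by simp
  moreover have "ssq (A \<times> B) (\<lambda>(a, b). f a b) = Q - T\<^sup>2 / (m * n)"
    by (simp add: ssq_def case_prod_unfold sum.cartesian_product' Q_def T_def R_def m_def n_def
        card_cartesian_product)
  moreover have "(\<Sum>b\<in>B. ssq A (\<lambda>a. f a b)) = Q - (\<Sum>b\<in>B. (S b)\<^sup>2) / m"
    by (simp add: ssq_def sum_subtractf Q S_def m_def sum_divide_distrib)
  moreover have "(\<Sum>a\<in>A. ssq B (f a)) = Q - (\<Sum>a\<in>A. (R a)\<^sup>2) / n"
    by (simp add: ssq_def sum_subtractf Q_def R_def n_def sum_divide_distrib)
  ultimately show ?thesis by linarith
qed (auto simp: ssq_def)

text \<open>This is the bias term for \<open>B\<close> when the centre is the mean over
  \<open>A\<close>; enlarging the sum from \<open>B\<close> to \<open>A\<close> only adds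
  squares.\<close>

lemma mean_subset_le_ssq:
  assumes "finite A" "B \<subseteq> A"
  shows "((\<Sum>x\<in>A. f x) / real (card A) - (\<Sum>x\<in>B. f x) / real (card B))\<^sup>2 * real (card B) \<le> ssq A f"
proof -
  let ?m = "(\<Sum>x\<in>A. f x) / real (card A)"
  have fB: "finite B" using assms finite_subset by blast
  have "real (card B) * (?m - (\<Sum>x\<in>B. f x) / real (card B))\<^sup>2 \<le> (\<Sum>x\<in>B. (f x - ?m)\<^sup>2)"
    using sum_diff_const_eq_ssq[OF fB, of f ?m] ssq_nonneg[OF fB, of f] by linarith
  also have "\<dots> \<le> (\<Sum>x\<in>A. (f x - ?m)\<^sup>2)"
    by (rule sum_mono2) (use assms in auto)
  also have "\<dots> = ssq A f" using ssq_eq_mean[OF assms(1), of f] by simp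
  finally show ?thesis by (simp add: mult.commute)
qed

text \<open>Law of total variance. Fibres of equal size make the first coordinate uniform, so the
  between-fibre term carries no weights.\<close>

lemma ssq_Sigma_eq:
  assumes "finite S" "\<And>a. a \<in> S \<Longrightarrow> finite (A a)" "\<And>a. a \<in> S \<Longrightarrow> card (A a) = N"
  shows "ssq (Sigma S A) (\<lambda>(a, y). F a y)
    = (\<Sum>a\<in>S. ssq (A a) (F a)) + real N * ssq S (\<lambda>a. (\<Sum>y\<in>A a. F a y) / real N)"
proof -
  have card: "card (Sigma S A) = card S * N"
    using assms by simp
  have s: "sum h (Sigma S A) = (\<Sum>a\<in>S. \<Sum>y\<in>A a. h (a, y))" for h :: "_ \<Rightarrow> real"
    using assms by (subst sum.Sigma) (auto simp: split_def)
  have "(\<Sum>a\<in>S. ssq (A a) (F a))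
      = (\<Sum>a\<in>S. \<Sum>y\<in>A a. (F a y)\<^sup>2) - (\<Sum>a\<in>S. (\<Sum>y\<in>A a. F a y)\<^sup>2) / real N"
    using assms by (simp add: ssq_def sum_subtractf sum_divide_distrib)
  moreover have "real N * ssq S (\<lambda>a. (\<Sum>y\<in>A a. F a y) / real N)
      = (\<Sum>a\<in>S. (\<Sum>y\<in>A a. F a y)\<^sup>2) / real N
        - (\<Sum>a\<in>S. (\<Sum>y\<in>A a. F a y))\<^sup>2 / (real (card S) * real N)"
    by (cases "N = 0")
      (simp_all add: ssq_def power_divide sum_divide_distrib[symmetric] field_simps power2_eq_square)
  ultimately show ?thesis
    by (simp add: ssq_def s card)
qed

text \<open>The means over two fibres are compared through the intersection of the fibres: each mean
  is close to the mean over the intersection, whose relative size is at least \<open>1 / K\<close>.\<close>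

lemma ssq_Sigma_le:
  assumes S: "finite S" "S \<noteq> {}" and A: "\<And>a. a \<in> S \<Longrightarrow> finite (A a)" "\<And>a. a \<in> S \<Longrightarrow> card (A a) = N"
    and N: "N > 0" and K: "\<And>a a'. a \<in> S \<Longrightarrow> a' \<in> S \<Longrightarrow> real N \<le> K * real (card (A a \<inter> A a'))"
  shows "ssq (Sigma S A) (\<lambda>(a, y). F a y)
    \<le> (1 + 3 * K) * (\<Sum>a\<in>S. ssq (A a) (F a))
      + 3 * K / (2 * real (card S)) * (\<Sum>a\<in>S. \<Sum>a'\<in>S. \<Sum>y\<in>A a \<inter> A a'. (F a y - F a' y)\<^sup>2)"
proof -
  define g where "g a = (\<Sum>y\<in>A a. F a y) / real N" for a
  define s where "s = real (card S)"
  have s: "s > 0" using S by (simp add: s_def card_gt_0_iff)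
  have pair: "real N * (g a - g a')\<^sup>2
      \<le> 3 * K * (ssq (A a) (F a) + ssq (A a') (F a') + (\<Sum>y\<in>A a \<inter> A a'. (F a y - F a' y)\<^sup>2))"
    if "a \<in> S" "a' \<in> S" for a a'
  proof -
    define B where "B = A a \<inter> A a'"
    define m where "m c = (\<Sum>y\<in>B. F c y) / real (card B)" for c
    have fB: "finite B" using A that by (auto simp: B_def)
    have NK: "real N \<le> K * real (card B)" using K that by (simp add: B_def)
    \<comment> \<open>\<open>N > 0\<close> and the overlap bound force the fibres to intersect and
      \<open>K\<close> to be positive.\<close>
    then have cB: "card B > 0" using N by (cases "card B = 0") auto
    then have K0: "K > 0" using NK N
      by (smt (verit) of_nat_0_less_iff mult_nonpos_nonneg of_nat_0_le_iff)
    have 1: "(g c - m c)\<^sup>2 * real (card B) \<le> ssq (A c) (F c)" if "c \<in> {a, a'}" for c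
      using mean_subset_le_ssq[of "A c" B "F c"] that \<open>a \<in> S\<close> \<open>a' \<in> S\<close> A
      by (auto simp: B_def g_def m_def)
    have "(m a - m a')\<^sup>2 = ((\<Sum>y\<in>B. F a y - F a' y) / real (card B))\<^sup>2"
      by (simp add: m_def sum_subtractf diff_divide_distrib)
    also have "\<dots> \<le> (\<Sum>y\<in>B. (F a y - F a' y)\<^sup>2) / real (card B)"
      by (rule mean_squared_le[OF fB])
    finally have 2: "(m a - m a')\<^sup>2 * real (card B) \<le> (\<Sum>y\<in>B. (F a y - F a' y)\<^sup>2)"
      using cB by (simp add: field_simps)
    \<comment> \<open>Cauchy-Schwarz for the route from \<open>g a\<close> through
      \<open>m a\<close> and \<open>m a'\<close> to \<open>g a'\<close>; this is the source of the
      factor 3.\<close>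
    have three: "(u + v + w)\<^sup>2 \<le> 3 * (u\<^sup>2 + v\<^sup>2 + w\<^sup>2)" for u v w :: real
      using sum_power2_ge_zero[of "u - v" "v - w"] zero_le_power2[of "u - w"]
      by (simp add: power2_eq_square algebra_simps)
    have "real N * (g a - g a')\<^sup>2 \<le> K * real (card B) * (g a - g a')\<^sup>2"
      using NK by (simp add: mult_right_mono)
    also have "(g a - g a')\<^sup>2 \<le> 3 * ((g a - m a)\<^sup>2 + (m a - m a')\<^sup>2 + (g a' - m a')\<^sup>2)"
      using three[of "g a - m a" "m a - m a'" "m a' - g a'"] by (simp add: power2_commute)
    also have "K * real (card B) * (3 * ((g a - m a)\<^sup>2 + (m a - m a')\<^sup>2 + (g a' - m a')\<^sup>2))
      = 3 * K * ((g a - m a)\<^sup>2 * real (card B) + (g a' - m a')\<^sup>2 * real (card B)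
          + (m a - m a')\<^sup>2 * real (card B))"
      by (simp add: algebra_simps)
    also have "\<dots> \<le> 3 * K * (ssq (A a) (F a) + ssq (A a') (F a') + (\<Sum>y\<in>B. (F a y - F a' y)\<^sup>2))"
      by (intro mult_left_mono add_mono 1 2) (use K0 in auto)
    finally show ?thesis using K0 cB by (simp add: B_def mult_left_mono)
  qed
  let ?Q = "\<Sum>a\<in>S. \<Sum>a'\<in>S. \<Sum>y\<in>A a \<inter> A a'. (F a y - F a' y)\<^sup>2"
  have "2 * s * (real N * ssq S g) = (\<Sum>a\<in>S. \<Sum>a'\<in>S. real N * (g a - g a')\<^sup>2)"
    using sum_pairs_eq_ssq[OF S(1), of g] by (simp add: sum_distrib_left[symmetric] s_def)
  also have "\<dots> \<le> (\<Sum>a\<in>S. \<Sum>a'\<in>S. 3 * K *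
      (ssq (A a) (F a) + ssq (A a') (F a') + (\<Sum>y\<in>A a \<inter> A a'. (F a y - F a' y)\<^sup>2)))"
    by (intro sum_mono pair)
  also have "\<dots> = 3 * K * (2 * s * (\<Sum>a\<in>S. ssq (A a) (F a)) + ?Q)"
    by (simp add: sum_distrib_left[symmetric] sum.distrib s_def)
  finally have "real N * ssq S g \<le> 3 * K * (\<Sum>a\<in>S. ssq (A a) (F a)) + 3 * K / (2 * s) * ?Q"
    using s by (simp add: field_simps)
  then show ?thesis
    using ssq_Sigma_eq[OF S(1) A, where F = F] by (simp add: g_def[abs_def] s_def algebra_simps)
qed

section \<open>Poincare inequalities for single-site recolouring\<close>

definition recolour :: "('v \<Rightarrow> nat) set \<Rightarrow> ('v \<Rightarrow> nat) \<Rightarrow> 'v \<Rightarrow> nat \<Rightarrow> ('v \<Rightarrow> nat)" where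
  "recolour \<Omega> x v c = (if x(v := c) \<in> \<Omega> then x(v := c) else x)"

text \<open>An unnormalised Dirichlet form: for proper colourings it is
  \<open>2 * card V * q\<close> times the sum of \<open>f * (f - P f)\<close>, with \<open>P\<close>
  the Metropolis operator. Without normalisation it is additive over \<open>V\<close>.\<close>

definition energy :: "nat \<Rightarrow> 'v set \<Rightarrow> ('v \<Rightarrow> nat) set \<Rightarrow> (('v \<Rightarrow> nat) \<Rightarrow> real) \<Rightarrow> real" where
  "energy q V \<Omega> f = (\<Sum>v\<in>V. \<Sum>x\<in>\<Omega>. \<Sum>c<q. (f x - f (recolour \<Omega> x v c))\<^sup>2)"

text \<open>The factor 2 reflects that \<open>energy\<close> counts every accepted recolouring from
  both of its ends. In these units \<open>C\<close> corresponds to a spectral gap of at least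
  \<open>1 / (card V * q * C)\<close>.\<close>

definition poincare :: "nat \<Rightarrow> 'v set \<Rightarrow> ('v \<Rightarrow> nat) set \<Rightarrow> real \<Rightarrow> bool" where
  "poincare q V \<Omega> C \<longleftrightarrow> (\<forall>f. 2 * ssq \<Omega> f \<le> C * energy q V \<Omega> f)"

lemma energy_nonneg: "energy q V \<Omega> f \<ge> 0"
  by (simp add: energy_def sum_nonneg)

section \<open>Attaching a root vertex\<close>

definition add_root :: "'v \<Rightarrow> nat set \<Rightarrow> (nat \<Rightarrow> ('v \<Rightarrow> nat) set) \<Rightarrow> ('v \<Rightarrow> nat) set" where
  "add_root r S A = (\<lambda>(a, y). y(r := a)) ` Sigma S A"

text \<open>A map in \<open>A a\<close> is \<open>undefined\<close> at \<open>r\<close>, so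
  \<open>y\<close> is recovered from \<open>y(r := a)\<close> by resetting that value.\<close>

lemma inj_on_add_root:
  assumes "r \<notin> U" "\<And>a. a \<in> S \<Longrightarrow> A a \<subseteq> extensional U"
  shows "inj_on (\<lambda>(a, y). y(r := a)) (Sigma S A)"
proof (rule inj_onI, clarify)
  fix a y a' y'
  assume *: "a \<in> S" "y \<in> A a" "a' \<in> S" "y' \<in> A a'" "y(r := a) = y'(r := a')"
  then have "y r = undefined" "y' r = undefined"
    using assms by (auto simp: extensional_def)
  then show "a = a' \<and> y = y'"
    using *(5) by (metis fun_upd_same fun_upd_triv fun_upd_upd)
qed

lemma fun_upd_in_add_root_iff:
  assumes "r \<notin> U" "\<And>a. a \<in> S \<Longrightarrow> A a \<subseteq> extensional U" "y \<in> extensional U"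
  shows "y(r := a) \<in> add_root r S A \<longleftrightarrow> a \<in> S \<and> y \<in> A a"
proof
  assume "y(r := a) \<in> add_root r S A"
  then obtain a' y' where *: "a' \<in> S" "y' \<in> A a'" "y(r := a) = y'(r := a')"
    by (auto simp: add_root_def)
  then have "y r = undefined" "y' r = undefined"
    using assms by (auto simp: extensional_def)
  then have "a = a' \<and> y = y'"
    using *(3) by (metis fun_upd_same fun_upd_triv fun_upd_upd)
  with * show "a \<in> S \<and> y \<in> A a" by simp
qed (auto simp: add_root_def)

text \<open>Root moves supply the pair sum of \<open>ssq_Sigma_le\<close> and moves in
  \<open>U\<close> supply the energies of the fibres; the two conditions on \<open>C'\<close>
  dominate the coefficients of these two parts.\<close>

lemma poincare_add_root:
  assumes r: "r \<notin> U" and ext: "\<And>a. a \<in> S \<Longrightarrow> A a \<subseteq> extensional U" and U: "finite U"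
    and S: "S \<subseteq> {..<q}" "2 \<le> card S"
    and A: "\<And>a. a \<in> S \<Longrightarrow> finite (A a)" "\<And>a. a \<in> S \<Longrightarrow> card (A a) = N" and N: "N > 0"
    and K: "\<And>a a'. a \<in> S \<Longrightarrow> a' \<in> S \<Longrightarrow> real N \<le> K * real (card (A a \<inter> A a'))"
    and P: "\<And>a. a \<in> S \<Longrightarrow> poincare q U (A a) C"
    and C': "(1 + 3 * K) * C \<le> C'" "3 * K / 2 \<le> C'" and K0: "K \<ge> 0"
  shows "poincare q (insert r U) (add_root r S A) C'"
  unfolding poincare_def
proof
  fix f :: "('a \<Rightarrow> nat) \<Rightarrow> real"
  define \<Omega> where "\<Omega> = add_root r S A"
  define F where "F a y = f (y(r := a))" for a y
  have fS: "finite S" "S \<noteq> {}" using S finite_subset by auto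
  have inj: "inj_on (\<lambda>(a, y). y(r := a)) (Sigma S A)"
    by (rule inj_on_add_root[OF r ext])
  have sum_\<Omega>: "sum h \<Omega> = (\<Sum>a\<in>S. \<Sum>y\<in>A a. h (y(r := a)))" for h :: "_ \<Rightarrow> real"
    unfolding \<Omega>_def add_root_def using inj fS A
    by (subst sum.reindex) (auto simp: split_def o_def sum.Sigma)
  have mem: "y(r := a) \<in> \<Omega> \<longleftrightarrow> a \<in> S \<and> y \<in> A a" if "y \<in> extensional U" for a y
    unfolding \<Omega>_def by (rule fun_upd_in_add_root_iff[OF r ext that])
  let ?Q = "\<Sum>a\<in>S. \<Sum>a'\<in>S. \<Sum>y\<in>A a \<inter> A a'. (F a y - F a' y)\<^sup>2"
  \<comment> \<open>Recolouring the root with \<open>c\<close> is accepted exactly when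
    \<open>c\<close> lies in \<open>S\<close> and \<open>y\<close> is admissible under
    \<open>c\<close>; a rejected move contributes 0.\<close>
  have "(\<Sum>x\<in>\<Omega>. \<Sum>c<q. (f x - f (recolour \<Omega> x r c))\<^sup>2) =
      (\<Sum>a\<in>S. \<Sum>y\<in>A a. \<Sum>c<q. if c \<in> S \<and> y \<in> A c then (F a y - F c y)\<^sup>2 else 0)"
    unfolding sum_\<Omega>
  proof (intro sum.cong refl)
    fix a y c assume "a \<in> S" "y \<in> A a"
    then have "y \<in> extensional U" using ext by auto
    then show "(f (y(r := a)) - f (recolour \<Omega> (y(r := a)) r c))\<^sup>2
        = (if c \<in> S \<and> y \<in> A c then (F a y - F c y)\<^sup>2 else 0)"
      by (simp add: recolour_def mem F_def)
  qed
  also have "\<dots> = (\<Sum>a\<in>S. \<Sum>y\<in>A a. \<Sum>c\<in>S. if y \<in> A c then (F a y - F c y)\<^sup>2 else 0)"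
    by (intro sum.cong refl sum.mono_neutral_cong_right) (use S in auto)
  also have "\<dots> = (\<Sum>a\<in>S. \<Sum>c\<in>S. \<Sum>y\<in>A a. if y \<in> A c then (F a y - F c y)\<^sup>2 else 0)"
    by (intro sum.cong refl sum.swap)
  also have "\<dots> = ?Q"
    using A by (simp add: sum.inter_restrict cong: sum.cong)
  finally have Er: "(\<Sum>x\<in>\<Omega>. \<Sum>c<q. (f x - f (recolour \<Omega> x r c))\<^sup>2) = ?Q" .
  \<comment> \<open>A move in \<open>U\<close> keeps the root colour and so stays in its
    fibre.\<close>
  have EU: "energy q U \<Omega> f = (\<Sum>a\<in>S. energy q U (A a) (F a))"
  proof -
    have "energy q U \<Omega> f
        = (\<Sum>v\<in>U. \<Sum>a\<in>S. \<Sum>y\<in>A a. \<Sum>c<q. (F a y - F a (recolour (A a) y v c))\<^sup>2)"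
      unfolding energy_def sum_\<Omega>
    proof (intro sum.cong refl)
      fix v a y c assume v: "v \<in> U" and a: "a \<in> S" and y: "y \<in> A a"
      have ne: "v \<noteq> r" using v r by auto
      have "y(v := c) \<in> extensional U" using v y a ext by (auto simp: extensional_def)
      from mem[OF this, of a] have "y(v := c, r := a) \<in> \<Omega> \<longleftrightarrow> y(v := c) \<in> A a" using a by simp
      then show "(f (y(r := a)) - f (recolour \<Omega> (y(r := a)) v c))\<^sup>2
          = (F a y - F a (recolour (A a) y v c))\<^sup>2"
        using ne by (simp add: recolour_def F_def fun_upd_twist)
    qed
    also have "\<dots> = (\<Sum>a\<in>S. energy q U (A a) (F a))"
      unfolding energy_def by (rule sum.swap)
    finally show ?thesis .
  qed
  have en: "energy q (insert r U) \<Omega> f = ?Q + energy q U \<Omega> f"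
    using r U Er by (simp add: energy_def)
  have Q0: "?Q \<ge> 0" by (intro sum_nonneg) auto
  have "2 * ssq \<Omega> f = 2 * ssq (Sigma S A) (\<lambda>(a, y). F a y)"
    unfolding \<Omega>_def add_root_def using inj by (simp add: ssq_reindex F_def split_def)
  also have "\<dots> \<le> 2 * ((1 + 3 * K) * (\<Sum>a\<in>S. ssq (A a) (F a)) + 3 * K / (2 * real (card S)) * ?Q)"
    by (intro mult_left_mono ssq_Sigma_le[OF fS A N K]) auto
  also have "\<dots> = (1 + 3 * K) * (\<Sum>a\<in>S. 2 * ssq (A a) (F a)) + 3 * K / real (card S) * ?Q"
    by (simp add: algebra_simps sum_distrib_left[symmetric])
  also have "\<dots> \<le> (1 + 3 * K) * (\<Sum>a\<in>S. C * energy q U (A a) (F a)) + 3 * K / 2 * ?Q"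
  proof (intro add_mono mult_left_mono mult_right_mono sum_mono)
    \<comment> \<open>\<open>card S \<ge> 2\<close> removes the dependence of the constant on
      \<open>S\<close>.\<close>
    show "3 * K / real (card S) \<le> 3 * K / 2"
      using S K0 by (intro divide_left_mono) auto
  qed (use P K0 Q0 in \<open>auto simp: poincare_def\<close>)
  also have "\<dots> = ((1 + 3 * K) * C) * energy q U \<Omega> f + 3 * K / 2 * ?Q"
    by (simp add: EU sum_distrib_left[symmetric])
  also have "\<dots> \<le> C' * energy q U \<Omega> f + C' * ?Q"
    by (intro add_mono mult_right_mono C' Q0 energy_nonneg)
  finally show "2 * ssq (add_root r S A) f \<le> C' * energy q (insert r U) (add_root r S A) f"
    by (simp add: en \<Omega>_def[symmetric] algebra_simps)
qed

section \<open>Tensorisation over disjoint vertex sets\<close>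

lemma inj_on_merge:
  assumes "U \<inter> W = {}" "Y \<subseteq> extensional U" "Z \<subseteq> extensional W"
  shows "inj_on (merge U W) (Y \<times> Z)"
proof (rule inj_on_inverseI)
  fix p assume "p \<in> Y \<times> Z"
  then show "(\<lambda>x. (restrict x U, restrict x W)) (merge U W p) = p"
    using assms by (auto simp: extensional_restrict subset_iff)
qed

lemma merge_in_image_iff:
  assumes "U \<inter> W = {}" "Y \<subseteq> extensional U" "Z \<subseteq> extensional W" "y \<in> extensional U" "z \<in> extensional W"
  shows "merge U W (y, z) \<in> merge U W ` (Y \<times> Z) \<longleftrightarrow> y \<in> Y \<and> z \<in> Z"
  using inj_on_image_mem_iff[OF inj_on_merge[OF assms(1) subset_refl subset_refl], of "(y, z)" "Y \<times> Z"]
    assms by auto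

text \<open>A move in \<open>U\<close> leaves the part \<open>z\<close> untouched, and its
  acceptance depends on \<open>Y\<close> alone.\<close>

lemma energy_merge:
  assumes "U \<inter> W = {}" "Y \<subseteq> extensional U" "Z \<subseteq> extensional W"
  shows "energy q U (merge U W ` (Y \<times> Z)) f = (\<Sum>z\<in>Z. energy q U Y (\<lambda>y. f (merge U W (y, z))))"
proof -
  have "energy q U (merge U W ` (Y \<times> Z)) f
      = (\<Sum>v\<in>U. \<Sum>y\<in>Y. \<Sum>z\<in>Z. \<Sum>c<q. (f (merge U W (y, z)) - f (merge U W (recolour Y y v c, z)))\<^sup>2)"
    unfolding energy_def sum.reindex[OF inj_on_merge[OF assms]] o_def sum.cartesian_product'
  proof (intro sum.cong refl)
    fix v y z c assume v: "v \<in> U" and y: "y \<in> Y" and z: "z \<in> Z"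
    have upd: "(merge U W (y, z))(v := c) = merge U W (y(v := c), z)"
      using v assms(1) by (auto simp: merge_def fun_eq_iff)
    have "y(v := c) \<in> extensional U" "z \<in> extensional W"
      using v y z assms by (auto simp: extensional_def)
    then show "(f (merge U W (y, z)) - f (recolour (merge U W ` (Y \<times> Z)) (merge U W (y, z)) v c))\<^sup>2
        = (f (merge U W (y, z)) - f (merge U W (recolour Y y v c, z)))\<^sup>2"
      using z merge_in_image_iff[OF assms, of "y(v := c)" z]
      by (simp add: recolour_def upd)
  qed
  also have "\<dots> = (\<Sum>v\<in>U. \<Sum>z\<in>Z. \<Sum>y\<in>Y. \<Sum>c<q. (f (merge U W (y, z)) - f (merge U W (recolour Y y v c, z)))\<^sup>2)"
    by (intro sum.cong refl sum.swap)
  also have "\<dots> = (\<Sum>z\<in>Z. energy q U Y (\<lambda>y. f (merge U W (y, z))))"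
    unfolding energy_def by (rule sum.swap)
  finally show ?thesis .
qed

text \<open>On a product the variance is bounded by the coordinatewise variances and the energy is
  additive, so \<open>C\<close> is inherited without loss.\<close>

lemma poincare_merge:
  assumes disj: "U \<inter> W = {}" and ext: "Y \<subseteq> extensional U" "Z \<subseteq> extensional W"
    and fin: "finite U" "finite W" "finite Y" "finite Z"
    and P: "poincare q U Y C" "poincare q W Z C"
  shows "poincare q (U \<union> W) (merge U W ` (Y \<times> Z)) C"
  unfolding poincare_def
proof
  fix f :: "('a \<Rightarrow> nat) \<Rightarrow> real"
  let ?\<Omega> = "merge U W ` (Y \<times> Z)"
  \<comment> \<open>Exchanging the two factors turns \<open>energy_merge\<close> into a formula for
    the moves in \<open>W\<close>.\<close>
  have swap: "merge U W (y, z) = merge W U (z, y)" for y z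
    using disj by (auto simp: merge_def fun_eq_iff)
  have sw\<Omega>: "?\<Omega> = merge W U ` (Z \<times> Y)"
    by (force simp: swap image_iff)
  have EW: "energy q W ?\<Omega> f = (\<Sum>y\<in>Y. energy q W Z (\<lambda>z. f (merge U W (y, z))))"
    unfolding sw\<Omega> using disj ext by (subst energy_merge) (auto simp: swap)
  have "2 * ssq ?\<Omega> f = 2 * ssq (Y \<times> Z) (\<lambda>(y, z). f (merge U W (y, z)))"
    by (simp add: ssq_reindex[OF inj_on_merge[OF disj ext]] split_def)
  also have "\<dots> \<le> 2 * ((\<Sum>z\<in>Z. ssq Y (\<lambda>y. f (merge U W (y, z)))) + (\<Sum>y\<in>Y. ssq Z (\<lambda>z. f (merge U W (y, z)))))"
    using ssq_Times_le[OF fin(3,4), of "\<lambda>y z. f (merge U W (y, z))"] by simp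
  also have "\<dots> = (\<Sum>z\<in>Z. 2 * ssq Y (\<lambda>y. f (merge U W (y, z)))) + (\<Sum>y\<in>Y. 2 * ssq Z (\<lambda>z. f (merge U W (y, z))))"
    by (simp add: sum_distrib_left)
  also have "\<dots> \<le> (\<Sum>z\<in>Z. C * energy q U Y (\<lambda>y. f (merge U W (y, z))))
      + (\<Sum>y\<in>Y. C * energy q W Z (\<lambda>z. f (merge U W (y, z))))"
    by (intro add_mono sum_mono) (use P in \<open>auto simp: poincare_def\<close>)
  also have "\<dots> = C * (energy q U ?\<Omega> f + energy q W ?\<Omega> f)"
    by (simp add: EW energy_merge[OF disj ext] sum_distrib_left[symmetric] distrib_left)
  also have "energy q U ?\<Omega> f + energy q W ?\<Omega> f = energy q (U \<union> W) ?\<Omega> f"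
    using disj fin by (simp add: energy_def sum.union_disjoint)
  finally show "2 * ssq ?\<Omega> f \<le> C * energy q (U \<union> W) ?\<Omega> f" .
qed

text \<open>For disjoint blocks \<open>V i\<close> this is the product of the \<open>X i\<close>,
  stored as single functions on the union of the blocks instead of as families, so that its elements
  are colourings again.\<close>

definition glue :: "'i set \<Rightarrow> ('i \<Rightarrow> 'v set) \<Rightarrow> ('i \<Rightarrow> ('v \<Rightarrow> nat) set) \<Rightarrow> ('v \<Rightarrow> nat) set" where
  "glue I V X = {x \<in> extensional (\<Union>i\<in>I. V i). \<forall>i\<in>I. restrict x (V i) \<in> X i}"

lemma glue_empty: "glue {} V X = {\<lambda>_. undefined}"
  by (auto simp: glue_def)

lemma glue_subset: "glue I V X \<subseteq> extensional (\<Union>i\<in>I. V i)"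
  by (auto simp: glue_def)

lemma glue_Int: "glue I V X \<inter> glue I V Y = glue I V (\<lambda>i. X i \<inter> Y i)"
  by (auto simp: glue_def)

text \<open>Restriction to the two blocks inverts \<open>merge\<close>. Peeling off one factor
  carries binary products over to finite ones by induction.\<close>

lemma glue_insert:
  assumes "V i \<inter> (\<Union>j\<in>I. V j) = {}" "X i \<subseteq> extensional (V i)"
  shows "glue (insert i I) V X = merge (V i) (\<Union>j\<in>I. V j) ` (X i \<times> glue I V X)"
    (is "_ = merge _ ?W ` _")
proof (intro equalityI subsetI)
  fix x assume x: "x \<in> glue (insert i I) V X"
  then have *: "x \<in> extensional (V i \<union> ?W)" "restrict x (V i) \<in> X i"
    "\<And>j. j \<in> I \<Longrightarrow> restrict x (V j) \<in> X j"
    by (auto simp: glue_def)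
  have "x = merge (V i) ?W (restrict x (V i), restrict x ?W)"
    using *(1) by (auto simp: merge_def fun_eq_iff extensional_def)
  moreover have "restrict x ?W \<in> glue I V X"
  proof -
    have "restrict (restrict x ?W) (V j) = restrict x (V j)" if "j \<in> I" for j
      using that by (auto simp: restrict_def fun_eq_iff)
    with *(3) show ?thesis by (auto simp: glue_def)
  qed
  ultimately show "x \<in> merge (V i) ?W ` (X i \<times> glue I V X)"
    using *(2) by blast
next
  fix x assume "x \<in> merge (V i) ?W ` (X i \<times> glue I V X)"
  then obtain y z where x: "x = merge (V i) ?W (y, z)" "y \<in> X i" "z \<in> glue I V X" by auto
  have "restrict x (V i) = y"
    using x assms by (auto simp: extensional_restrict subset_iff)
  moreover have "restrict x (V j) = restrict z (V j)" if "j \<in> I" for j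
    unfolding x using that assms(1) by (auto simp: merge_def restrict_def fun_eq_iff)
  ultimately show "x \<in> glue (insert i I) V X"
    using x by (auto simp: glue_def)
qed

lemma
  assumes "finite I"
    and "\<And>i j. i \<in> I \<Longrightarrow> j \<in> I \<Longrightarrow> i \<noteq> j \<Longrightarrow> V i \<inter> V j = {}"
    and "\<And>i. i \<in> I \<Longrightarrow> X i \<subseteq> extensional (V i)" "\<And>i. i \<in> I \<Longrightarrow> finite (X i)"
  shows finite_glue: "finite (glue I V X)"
    and card_glue: "card (glue I V X) = (\<Prod>i\<in>I. card (X i))"
proof -
  have "finite (glue I V X) \<and> card (glue I V X) = (\<Prod>i\<in>I. card (X i))"
    using assms
  proof (induction I)
    case empty
    then show ?case by (simp add: glue_empty)
  next
    case (insert i I)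
    have disj: "V i \<inter> (\<Union>j\<in>I. V j) = {}" using insert.hyps insert.prems(1) by fastforce
    have IH: "finite (glue I V X)" "card (glue I V X) = (\<Prod>i\<in>I. card (X i))"
      using insert.IH insert.prems by auto
    have "X i \<subseteq> extensional (V i)" using insert.prems by blast
    then show ?case
      using IH insert disj
      by (simp add: glue_insert card_image[OF inj_on_merge[OF disj _ glue_subset]] card_cartesian_product)
  qed
  then show "finite (glue I V X)" "card (glue I V X) = (\<Prod>i\<in>I. card (X i))" by auto
qed

lemma poincare_glue:
  assumes "finite I" "\<And>i j. i \<in> I \<Longrightarrow> j \<in> I \<Longrightarrow> i \<noteq> j \<Longrightarrow> V i \<inter> V j = {}"
    and "\<And>i. i \<in> I \<Longrightarrow> X i \<subseteq> extensional (V i)" "\<And>i. i \<in> I \<Longrightarrow> finite (X i)"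
    and "\<And>i. i \<in> I \<Longrightarrow> finite (V i)" "\<And>i. i \<in> I \<Longrightarrow> poincare q (V i) (X i) C"
  shows "poincare q (\<Union>i\<in>I. V i) (glue I V X) C"
  using assms
proof (induction I)
  case empty
  then show ?case by (simp add: glue_empty poincare_def ssq_def energy_def)
next
  case (insert i I)
  have disj: "V i \<inter> (\<Union>j\<in>I. V j) = {}" using insert.hyps insert.prems(1) by fastforce
  have "poincare q (V i \<union> (\<Union>j\<in>I. V j)) (merge (V i) (\<Union>j\<in>I. V j) ` (X i \<times> glue I V X)) C"
    by (rule poincare_merge[OF disj _ glue_subset])
      (use insert.hyps insert.prems in \<open>simp_all add: finite_glue insert.IH\<close>)
  moreover have "X i \<subseteq> extensional (V i)" using insert.prems by blast
  ultimately show ?case by (simp add: glue_insert disj)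
qed

section \<open>Colourings of trees\<close>

lemma proper_colourings_subset:
  "proper_colourings V adj q \<subseteq> V \<rightarrow>\<^sub>E {..<q}"
  by (auto simp: proper_colourings_def)

lemma finite_proper_colourings: "finite V \<Longrightarrow> finite (proper_colourings V adj q)"
  by (rule finite_subset[OF proper_colourings_subset]) (auto intro: finite_PiE)

text \<open>Paths store the latest step first, so descendants of \<open>w\<close> have
  \<open>w\<close> as a suffix and \<open>tree_adj\<close> applies to them unchanged.\<close>

definition subtree :: "nat \<Rightarrow> nat \<Rightarrow> nat list \<Rightarrow> nat list set" where
  "subtree b h w = (\<lambda>u. u @ w) ` tree_verts b h"

text \<open>The induction needs a restricted root, because a coloured parent forbids one colour at
  its child.\<close>

definition tree_cols :: "nat \<Rightarrow> nat \<Rightarrow> nat \<Rightarrow> nat list \<Rightarrow> nat set \<Rightarrow> (nat list \<Rightarrow> nat) set" where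
  "tree_cols b q h w S = {x \<in> proper_colourings (subtree b h w) tree_adj q. x w \<in> S}"

text \<open>With \<open>L = {..<q} - {a}\<close> these are the ways to colour everything below
  \<open>w\<close> once \<open>w\<close> has colour \<open>a\<close>.\<close>

definition forest_cols :: "nat \<Rightarrow> nat \<Rightarrow> nat \<Rightarrow> nat list \<Rightarrow> nat set \<Rightarrow> (nat list \<Rightarrow> nat) set" where
  "forest_cols b q h w L =
     glue {..<b} (\<lambda>i. subtree b h (i # w)) (\<lambda>i. tree_cols b q h (i # w) L)"

lemma finite_tree_verts: "finite (tree_verts b h)"
  unfolding tree_verts_def by (rule finite_lists_length_le) simp

lemma finite_subtree: "finite (subtree b h w)"
  by (simp add: subtree_def finite_tree_verts)

section \<open>Subtrees, their edges and the decomposition at the root\<close>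

lemma subtree_0: "subtree b 0 w = {w}"
  by (auto simp: subtree_def tree_verts_def)

lemma root_in_subtree: "w \<in> subtree b h w"
  by (force simp: subtree_def tree_verts_def)

lemma subtree_Suc: "subtree b (Suc h) w = insert w (\<Union>i<b. subtree b h (i # w))"
proof (intro equalityI subsetI)
  fix v assume "v \<in> subtree b (Suc h) w"
  then obtain u where u: "v = u @ w" "set u \<subseteq> {..<b}" "length u \<le> Suc h"
    by (auto simp: subtree_def tree_verts_def)
  show "v \<in> insert w (\<Union>i<b. subtree b h (i # w))"
  \<comment> \<open>The last entry of \<open>u\<close> is the first step away from \<open>w\<close>
    and names the child whose subtree contains \<open>v\<close>.\<close>
  proof (cases u rule: rev_cases)
    case (snoc u' i)
    with u have "u' \<in> tree_verts b h" "i < b" "v = u' @ i # w"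
      by (auto simp: tree_verts_def)
    then show ?thesis by (auto simp: subtree_def)
  qed (use u in simp)
next
  fix v assume "v \<in> insert w (\<Union>i<b. subtree b h (i # w))"
  then consider "v = w" | u i where "i < b" "u \<in> tree_verts b h" "v = u @ i # w"
    by (auto simp: subtree_def)
  then show "v \<in> subtree b (Suc h) w"
  proof cases
    case 2
    then have "u @ [i] \<in> tree_verts b (Suc h)" "v = (u @ [i]) @ w"
      by (auto simp: tree_verts_def)
    then show ?thesis unfolding subtree_def by blast
  qed (simp add: root_in_subtree)
qed

text \<open>The entry just in front of the suffix \<open>w\<close> identifies the child.\<close>

lemma in_subtree_same:
  assumes "u \<in> subtree b h (i # w)" "u \<in> subtree b h' (j # w)"
  shows "i = j"
proof -
  obtain p p' where "u = p @ i # w" "u = p' @ j # w"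
    using assms by (auto simp: subtree_def)
  then have "(p @ [i]) @ w = (p' @ [j]) @ w" by simp
  then show ?thesis by (simp only: append_same_eq append1_eq_conv)
qed

lemma subtree_disjoint: "i \<noteq> j \<Longrightarrow> subtree b h (i # w) \<inter> subtree b h (j # w) = {}"
  using in_subtree_same by blast

lemma root_notin_subtree: "w \<notin> subtree b h (i # w)"
  by (auto simp: subtree_def)

lemma tree_adj_commute: "tree_adj u v \<longleftrightarrow> tree_adj v u"
  by (auto simp: tree_adj_def)

lemma not_tree_adj_refl: "\<not> tree_adj u u"
  by (auto simp: tree_adj_def)

text \<open>An edge adds or drops an entry at the front of the list, which leaves the entry next to
  the suffix \<open>w\<close> alone.\<close>

lemma tree_adj_subtree_same:
  assumes "u \<in> subtree b h (i # w)" "v \<in> subtree b h (j # w)" "tree_adj u v"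
  shows "i = j"
proof -
  have *: "k = l" if uv: "u' = m # v'" "u' \<in> subtree b h (k # w)" "v' \<in> subtree b h (l # w)" for u' v' k l m
  proof -
    obtain p p' where "u' = p @ k # w" "v' = p' @ l # w"
      using uv(2,3) by (auto simp: subtree_def)
    with uv(1) have "(p @ [k]) @ w = ((m # p') @ [l]) @ w" by simp
    then show ?thesis by (simp only: append_same_eq append1_eq_conv)
  qed
  show ?thesis using assms *[of u _ v i j] *[of v _ u j i] by (auto simp: tree_adj_def)
qed

lemma tree_adj_root_iff:
  assumes "v \<in> subtree b h (i # w)"
  shows "tree_adj w v \<longleftrightarrow> v = i # w"
proof -
  obtain p where "v = p @ i # w" using assms by (auto simp: subtree_def)
  then show ?thesis by (cases p) (auto simp: tree_adj_def append_eq_Cons_conv Cons_eq_append_conv)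
qed

text \<open>Every edge joins \<open>w\<close> to a child or stays inside one child subtree, so the
  root and the subtrees interact only through the children avoiding the colour of
  \<open>w\<close>.\<close>

lemma proper_colourings_subtree_Suc_iff:
  "x \<in> proper_colourings (subtree b (Suc h) w) tree_adj q \<longleftrightarrow>
    x \<in> extensional (subtree b (Suc h) w) \<and> x w < q \<and>
    (\<forall>i<b. restrict x (subtree b h (i # w)) \<in> tree_cols b q h (i # w) ({..<q} - {x w}))"
  (is "?L \<longleftrightarrow> ?R")
proof
  assume L: ?L
  have mem: "i < b \<Longrightarrow> v \<in> subtree b h (i # w) \<Longrightarrow> v \<in> subtree b (Suc h) w" for i v
    by (auto simp: subtree_Suc)
  have root: "w \<in> subtree b (Suc h) w" by (rule root_in_subtree)
  have adj: "tree_adj w (i # w)" for i by (auto simp: tree_adj_def)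
  show ?R
  proof (intro conjI allI impI)
    fix i assume i: "i < b"
    have "x w \<noteq> x (i # w)"
      using L root mem[OF i root_in_subtree] adj by (auto simp: proper_colourings_def)
    moreover have "x (i # w) < q"
      using L mem[OF i root_in_subtree] by (auto simp: proper_colourings_def PiE_def Pi_def)
    ultimately show "restrict x (subtree b h (i # w)) \<in> tree_cols b q h (i # w) ({..<q} - {x w})"
      using L mem[OF i]
      by (auto simp: tree_cols_def root_in_subtree proper_colourings_def PiE_def Pi_def)
  qed (use L root in \<open>auto simp: proper_colourings_def PiE_def Pi_def\<close>)
next
  assume R: ?R
  let ?T = "\<lambda>i. subtree b h (i # w)"
  have col: "v \<in> ?T i \<Longrightarrow> x v < q" if "i < b" for i v
    using R that by (force simp: tree_cols_def proper_colourings_def PiE_def Pi_def)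
  have inner: "u \<in> ?T i \<Longrightarrow> v \<in> ?T i \<Longrightarrow> tree_adj u v \<Longrightarrow> x u \<noteq> x v" if "i < b" for i u v
    using R that by (fastforce simp: tree_cols_def proper_colourings_def)
  have root: "v \<in> ?T i \<Longrightarrow> tree_adj w v \<Longrightarrow> x v \<noteq> x w" if "i < b" for i v
    using R that by (auto simp: tree_cols_def tree_adj_root_iff root_in_subtree)
  have neq: "x u \<noteq> x v" if uv: "u \<in> subtree b (Suc h) w" "v \<in> subtree b (Suc h) w" "tree_adj u v" for u v
  proof -
    consider "u = w" "v = w" | i where "i < b" "u = w" "v \<in> ?T i" | i where "i < b" "u \<in> ?T i" "v = w"
      | i j where "i < b" "j < b" "u \<in> ?T i" "v \<in> ?T j"
      using uv(1,2) by (auto simp: subtree_Suc)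
    then show ?thesis
    proof cases
      case 1
      then show ?thesis using uv(3) not_tree_adj_refl by simp
    next
      case (2 i)
      then show ?thesis using uv(3) root[of i v] by auto
    next
      case (3 i)
      then show ?thesis using uv(3) root[of i u] tree_adj_commute by auto
    next
      case (4 i j)
      then have "i = j" using tree_adj_subtree_same uv(3) by blast
      then show ?thesis using 4 uv(3) inner[of i u v] by simp
    qed
  qed
  have "x \<in> subtree b (Suc h) w \<rightarrow>\<^sub>E {..<q}"
    using R col by (auto simp: PiE_def Pi_def subtree_Suc)
  with neq show ?L by (simp add: proper_colourings_def)
qed

text \<open>The recursion to which \<open>poincare_add_root\<close> applies: given the root colour,
  the colouring below is a product over the children.\<close>

lemma tree_cols_Suc:
  assumes "S \<subseteq> {..<q}"
  shows "tree_cols b q (Suc h) w S = add_root w S (\<lambda>a. forest_cols b q h w ({..<q} - {a}))"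
    (is "_ = add_root w S ?A")
proof (intro equalityI subsetI)
  let ?U = "\<Union>i<b. subtree b h (i # w)"
  fix x assume "x \<in> tree_cols b q (Suc h) w S"
  then have "x \<in> proper_colourings (subtree b (Suc h) w) tree_adj q" "x w \<in> S"
    by (simp_all add: tree_cols_def)
  then have x: "x w \<in> S" "x \<in> extensional (insert w ?U)"
    "\<And>i. i < b \<Longrightarrow> restrict x (subtree b h (i # w)) \<in> tree_cols b q h (i # w) ({..<q} - {x w})"
    unfolding proper_colourings_subtree_Suc_iff by (simp_all add: subtree_Suc)
  have "x = (restrict x ?U)(w := x w)"
    using x(2) by (auto simp: fun_eq_iff extensional_def)
  moreover have "restrict x ?U \<in> ?A (x w)"
  proof -
    have "restrict (restrict x ?U) (subtree b h (i # w)) = restrict x (subtree b h (i # w))" if "i < b" for i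
      using that by (auto simp: restrict_def fun_eq_iff)
    with x(3) show ?thesis by (auto simp: forest_cols_def glue_def)
  qed
  ultimately show "x \<in> add_root w S ?A"
    using x(1) by (auto simp: add_root_def image_iff intro!: bexI[of _ "(x w, restrict x ?U)"])
next
  let ?U = "\<Union>i<b. subtree b h (i # w)"
  fix x assume "x \<in> add_root w S ?A"
  then obtain a y where x: "x = y(w := a)" "a \<in> S" "y \<in> ?A a" by (auto simp: add_root_def)
  have r: "restrict x (subtree b h (i # w)) = restrict y (subtree b h (i # w))" for i
    using root_notin_subtree[of w b h i] by (auto simp: x(1) restrict_def fun_eq_iff)
  have "x \<in> extensional (insert w ?U)"
    using x by (auto simp: forest_cols_def glue_def extensional_def)
  moreover have "x w = a" "a < q" using x assms by auto
  moreover have "restrict x (subtree b h (i # w)) \<in> tree_cols b q h (i # w) ({..<q} - {a})" if "i < b" for i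
    using x(3) that unfolding r by (simp add: forest_cols_def glue_def)
  ultimately have "x \<in> proper_colourings (subtree b (Suc h) w) tree_adj q"
    unfolding proper_colourings_subtree_Suc_iff by (simp add: subtree_Suc)
  with x show "x \<in> tree_cols b q (Suc h) w S" by (simp add: tree_cols_def)
qed

text \<open>A single vertex is a root added to the empty vertex set, whose only colouring is the
  constantly undefined map; the base case can thus use the same lemmas as the step.\<close>

lemma tree_cols_0:
  assumes "S \<subseteq> {..<q}"
  shows "tree_cols b q 0 w S = add_root w S (\<lambda>_. {\<lambda>_. undefined})"
proof -
  have "x \<in> tree_cols b q 0 w S \<longleftrightarrow> x \<in> extensional {w} \<and> x w \<in> S" for x
    using assms not_tree_adj_refl
    by (auto simp: tree_cols_def subtree_0 proper_colourings_def PiE_def Pi_def)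
  moreover have "add_root w S (\<lambda>_. {\<lambda>_. undefined}) = {x \<in> extensional {w}. x w \<in> S}"
  proof (intro equalityI subsetI)
    fix x :: "nat list \<Rightarrow> nat" assume x: "x \<in> {x \<in> extensional {w}. x w \<in> S}"
    show "x \<in> add_root w S (\<lambda>_. {\<lambda>_. undefined})"
      unfolding add_root_def
      by (rule image_eqI[of _ _ "(x w, \<lambda>_. undefined)"])
        (use x in \<open>auto simp: extensional_def fun_eq_iff\<close>)
  qed (auto simp: add_root_def extensional_def)
  ultimately show ?thesis by auto
qed

section \<open>Counting colourings, and the Poincare constant of a tree\<close>

lemma tree_cols_extensional: "tree_cols b q h w S \<subseteq> extensional (subtree b h w)"
  by (auto simp: tree_cols_def proper_colourings_def PiE_def)

lemma finite_tree_cols: "finite (tree_cols b q h w S)"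
  by (simp add: tree_cols_def finite_proper_colourings finite_subtree)

lemma forest_cols_extensional:
  "forest_cols b q h w L \<subseteq> extensional (\<Union>i<b. subtree b h (i # w))"
  by (simp add: forest_cols_def glue_subset)

lemma finite_forest_cols: "finite (forest_cols b q h w L)"
  unfolding forest_cols_def
  by (rule finite_glue) (simp_all add: subtree_disjoint finite_tree_cols tree_cols_extensional)

lemma card_forest_cols:
  assumes "\<And>i. i < b \<Longrightarrow> card (tree_cols b q h (i # w) L) = k"
  shows "card (forest_cols b q h w L) = k ^ b"
  unfolding forest_cols_def
  using assms by (subst card_glue) (simp_all add: subtree_disjoint finite_tree_cols tree_cols_extensional)

text \<open>The overlap of two fibres is again a forest of the same kind, so
  \<open>card_forest_cols\<close> gives its size.\<close>

lemma forest_cols_Int: "forest_cols b q h w L \<inter> forest_cols b q h w L' = forest_cols b q h w (L \<inter> L')"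
proof -
  have "tree_cols b q h w L \<inter> tree_cols b q h w L' = tree_cols b q h w (L \<inter> L')" for w
    by (auto simp: tree_cols_def)
  then show ?thesis by (simp add: forest_cols_def glue_Int)
qed

lemma poincare_forest_cols:
  assumes "\<And>i. i < b \<Longrightarrow> poincare q (subtree b h (i # w)) (tree_cols b q h (i # w) L) C"
  shows "poincare q (\<Union>i<b. subtree b h (i # w)) (forest_cols b q h w L) C"
  unfolding forest_cols_def
  using assms
  by (intro poincare_glue)
    (simp_all add: subtree_disjoint finite_tree_cols finite_subtree tree_cols_extensional)

lemma card_add_root:
  assumes "r \<notin> U" "\<And>a. a \<in> S \<Longrightarrow> A a \<subseteq> extensional U"
    and "finite S" "\<And>a. a \<in> S \<Longrightarrow> finite (A a)" "\<And>a. a \<in> S \<Longrightarrow> card (A a) = N"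
  shows "card (add_root r S A) = card S * N"
  unfolding add_root_def using assms by (simp add: card_image inj_on_add_root)

text \<open>Each root colour leaves \<open>q - 1\<close> colours to every child, so \<open>M\<close>
  starts at 1 and becomes \<open>((q - 1) * M) ^ b\<close> one level up, whatever the root colour.
  This provides the equal fibre sizes.\<close>

lemma card_tree_cols:
  assumes "q \<ge> 2"
  shows "\<exists>M>0. \<forall>w S. S \<subseteq> {..<q} \<longrightarrow> card (tree_cols b q h w S) = card S * M"
proof (induction h)
  case 0
  have "card (tree_cols b q 0 w S) = card S * 1" if "S \<subseteq> {..<q}" for w S
    unfolding tree_cols_0[OF that] using that finite_subset
    by (intro card_add_root[of _ "{}"]) (auto simp: extensional_def)
  then show ?case by (intro exI[of _ 1]) auto
next
  case (Suc h)
  then obtain M where M: "M > 0" "\<And>w S. S \<subseteq> {..<q} \<Longrightarrow> card (tree_cols b q h w S) = card S * M"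
    by auto
  have "card (tree_cols b q (Suc h) w S) = card S * ((q - 1) * M) ^ b" if S: "S \<subseteq> {..<q}" for w S
    unfolding tree_cols_Suc[OF S]
  proof (rule card_add_root[where U = "\<Union>i<b. subtree b h (i # w)"])
    fix a assume "a \<in> S"
    then have "a < q" using S by auto
    then show "card (forest_cols b q h w ({..<q} - {a})) = ((q - 1) * M) ^ b"
      by (intro card_forest_cols) (simp add: M(2))
  qed (use S finite_subset in \<open>auto simp: root_notin_subtree finite_forest_cols forest_cols_extensional[THEN subsetD]\<close>)
  then show ?case using M(1) assms by (intro exI[of _ "((q - 1) * M) ^ b"]) auto
qed

lemma poincare_tree_cols:
  assumes "q \<ge> 3" "S \<subseteq> {..<q}" "card S \<ge> 2"
  shows "poincare q (subtree b h w) (tree_cols b q h w S) (3 / 2 * (1 + 3 * 2 ^ b) ^ h)"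
  using assms(2,3)
proof (induction h arbitrary: w S)
  case 0
  \<comment> \<open>One-point fibres have no inner variance, so \<open>C = 0\<close> works, and
    \<open>K = 1\<close> leaves only \<open>3 * K / 2\<close>.\<close>
  have "poincare q (insert w {}) (add_root w S (\<lambda>_. {\<lambda>_. undefined})) (3 / 2)"
    by (rule poincare_add_root[where N = 1 and K = 1 and C = 0])
      (use 0 in \<open>auto simp: extensional_def poincare_def ssq_def\<close>)
  then show ?case using tree_cols_0[OF 0(1)] by (simp add: subtree_0)
next
  case (Suc h)
  obtain M where M: "M > 0" "\<And>w S. S \<subseteq> {..<q} \<Longrightarrow> card (tree_cols b q h w S) = card S * M"
    using card_tree_cols[of q b h] assms(1) by auto
  define A where "A a = forest_cols b q h w ({..<q} - {a})" for a
  let ?C = "3 / 2 * (1 + 3 * 2 ^ b) ^ h :: real"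
  have "poincare q (insert w (\<Union>i<b. subtree b h (i # w))) (add_root w S A) (3 / 2 * (1 + 3 * 2 ^ b) ^ Suc h)"
  proof (rule poincare_add_root[where N = "((q - 1) * M) ^ b" and K = "2 ^ b" and C = ?C])
    fix a assume a: "a \<in> S"
    then have "a < q" using Suc.prems by auto
    then show "card (A a) = ((q - 1) * M) ^ b"
      unfolding A_def by (intro card_forest_cols) (simp add: M(2))
    \<comment> \<open>The induction hypothesis asks for two colours at every child; this is where
      \<open>q \<ge> 3\<close> enters.\<close>
    have "card ({..<q} - {a}) \<ge> 2" using assms(1) \<open>a < q\<close> by simp
    then show "poincare q (\<Union>i<b. subtree b h (i # w)) (A a) ?C"
      unfolding A_def by (intro poincare_forest_cols Suc.IH) auto
  next
    fix a a' assume "a \<in> S" "a' \<in> S"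
    have "({..<q} - {a}) \<inter> ({..<q} - {a'}) = {..<q} - {a, a'}" by auto
    then have "card (A a \<inter> A a') = (card ({..<q} - {a, a'}) * M) ^ b"
      unfolding A_def forest_cols_Int by (intro card_forest_cols) (simp add: M(2))
    moreover have "q - 2 \<le> card ({..<q} - {a, a'})"
    proof -
      have "card {a, a'} \<le> 2" by (simp add: card_insert_if)
      then show ?thesis using diff_card_le_card_Diff[of "{a, a'}" "{..<q}"] by simp
    qed
    ultimately have "((q - 2) * M) ^ b \<le> card (A a \<inter> A a')"
      by (simp add: power_mono)
    \<comment> \<open>\<open>q \<ge> 3\<close> gives \<open>q - 1 \<le> 2 * (q - 2)\<close>; over
      \<open>b\<close> independent subtrees this costs the factor \<open>2 ^ b\<close>.\<close>
    moreover have "((q - 1) * M) ^ b \<le> (2 * ((q - 2) * M)) ^ b"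
      using assms(1) by (intro power_mono) (auto simp flip: mult.assoc)
    ultimately have "((q - 1) * M) ^ b \<le> 2 ^ b * card (A a \<inter> A a')"
      unfolding power_mult_distrib[of 2] using mult_le_mono2 le_trans by blast
    then have "real (((q - 1) * M) ^ b) \<le> real (2 ^ b * card (A a \<inter> A a'))"
      by (rule of_nat_mono)
    then show "real (((q - 1) * M) ^ b) \<le> 2 ^ b * real (card (A a \<inter> A a'))" by simp
  next
    have "3 * 2 ^ b / 2 \<le> 3 / 2 * (1 + 3 * 2 ^ b :: real) ^ 1" by simp
    also have "\<dots> \<le> 3 / 2 * (1 + 3 * 2 ^ b) ^ Suc h"
      by (intro mult_left_mono power_increasing) auto
    finally show "3 * 2 ^ b / 2 \<le> 3 / 2 * (1 + 3 * 2 ^ b :: real) ^ Suc h" .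
  qed (use Suc.prems M(1) assms(1) in \<open>auto simp: root_notin_subtree A_def finite_subtree finite_forest_cols
      forest_cols_extensional[THEN subsetD]\<close>)
  then show ?case
    unfolding tree_cols_Suc[OF Suc.prems(1)] subtree_Suc A_def[abs_def] .
qed

lemma subtree_Nil: "subtree b H [] = tree_verts b H"
  by (simp add: subtree_def)

lemma tree_cols_Nil:
  "tree_cols b q H [] {..<q} = proper_colourings (tree_verts b H) tree_adj q"
  using root_in_subtree[of "[]" b H]
  by (auto simp: tree_cols_def subtree_Nil proper_colourings_def PiE_def Pi_def)

lemma poincare_tree:
  assumes "q \<ge> 3"
  shows "poincare q (tree_verts b H) (proper_colourings (tree_verts b H) tree_adj q)
    (3 / 2 * (1 + 3 * 2 ^ b) ^ H)"
  using poincare_tree_cols[OF assms, of "{..<q}" b H "[]"] assms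
  by (simp add: subtree_Nil tree_cols_Nil)

lemma proper_colourings_tree_nonempty:
  assumes "q \<ge> 2"
  shows "proper_colourings (tree_verts b H) tree_adj q \<noteq> {}"
proof -
  obtain M where "M > 0" "card (tree_cols b q H [] {..<q}) = card {..<q} * M"
    using card_tree_cols[OF assms, of b H] by auto
  then show ?thesis using assms by (auto simp: tree_cols_Nil)
qed

section \<open>From the Poincare inequality to the mixing time\<close>

lemma sum_recolour_eq_sum_fibre:
  fixes x :: "'v \<Rightarrow> nat"
  assumes "finite \<Omega>" and "\<Omega> \<subseteq> {x. x v < q}" and x: "x \<in> \<Omega>"
  shows "(\<Sum>c<q. f (recolour \<Omega> x v c)) =
    (\<Sum>y\<in>{y\<in>\<Omega>. y(v := 0) = x(v := 0)}. f y)
    + (real q - real (card {y\<in>\<Omega>. y(v := 0) = x(v := 0)})) * f x"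
    (is "_ = sum f ?F + _")
proof -
  let ?C = "{c. c < q \<and> x(v := c) \<in> \<Omega>}"
  \<comment> \<open>Setting \<open>v\<close> to 0 erases its colour, so \<open>?F\<close> holds the
    configurations that differ from \<open>x\<close> at most at \<open>v\<close>. The accepted
    colours enumerate it; each rejected colour returns \<open>x\<close> and feeds the diagonal
    term.\<close>
  have bij: "bij_betw (\<lambda>c. x(v := c)) ?C ?F"
  proof (rule bij_betwI[where g = "\<lambda>y. y v"])
    show "(\<lambda>y. y v) \<in> ?F \<rightarrow> ?C"
    proof
      fix y assume y: "y \<in> ?F"
      then have "x(v := y v) = y" by (metis (mono_tags, lifting) fun_upd_triv fun_upd_upd mem_Collect_eq)
      with y assms show "y v \<in> ?C" by auto
    qed
    show "x(v := y v) = y" if "y \<in> ?F" for y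
      using that by (metis (mono_tags, lifting) fun_upd_triv fun_upd_upd mem_Collect_eq)
  qed auto
  have "(\<Sum>c<q. f (recolour \<Omega> x v c)) = (\<Sum>c\<in>?C. f (recolour \<Omega> x v c)) + (\<Sum>c\<in>{..<q} - ?C. f (recolour \<Omega> x v c))"
    by (subst sum.subset_diff[of ?C]) auto
  also have "(\<Sum>c\<in>?C. f (recolour \<Omega> x v c)) = (\<Sum>c\<in>?C. f (x(v := c)))"
    by (rule sum.cong) (auto simp: recolour_def)
  also have "\<dots> = sum f ?F" by (rule sum.reindex_bij_betw[OF bij])
  also have "(\<Sum>c\<in>{..<q} - ?C. f (recolour \<Omega> x v c)) = (\<Sum>c\<in>{..<q} - ?C. f x)"
    by (rule sum.cong) (auto simp: recolour_def)
  also have "\<dots> = real (card ({..<q} - ?C)) * f x" by simp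
  also have "real (card ({..<q} - ?C)) = real q - real (card ?F)"
  proof -
    have "card ?C = card ?F" by (rule bij_betw_same_card[OF bij])
    moreover have "card ({..<q} - ?C) = q - card ?C" by (subst card_Diff_subset) auto
    moreover have "card ?C \<le> q" using card_mono[of "{..<q}" ?C] by auto
    ultimately show ?thesis by simp
  qed
  finally show ?thesis .
qed

lemma sum_fibre_sym:
  fixes f g :: "'a \<Rightarrow> real"
  shows "(\<Sum>x\<in>A. g x * (\<Sum>y\<in>{y\<in>A. \<rho> y = \<rho> x}. f y)) = (\<Sum>x\<in>A. f x * (\<Sum>y\<in>{y\<in>A. \<rho> y = \<rho> x}. g y))"
proof (cases "finite A")
  case True
  have *: "(\<Sum>x\<in>A. g x * (\<Sum>y\<in>{y\<in>A. \<rho> y = \<rho> x}. f y)) = (\<Sum>x\<in>A. \<Sum>y\<in>A. if \<rho> y = \<rho> x then g x * f y else 0)"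
    for f g :: "'a \<Rightarrow> real"
    unfolding sum_distrib_left by (rule sum.cong[OF refl]) (simp add: sum.inter_filter True)
  
  show ?thesis
    unfolding * by (subst sum.swap) (auto intro!: sum.cong)
qed simp

text \<open>On each fibre of \<open>\<rho>\<close> the quadratic form is the square of the sum of
  \<open>f\<close>.\<close>

lemma sum_fibre_nonneg:
  fixes f :: "'a \<Rightarrow> real"
  assumes "finite A"
  shows "0 \<le> (\<Sum>x\<in>A. f x * (\<Sum>y\<in>{y\<in>A. \<rho> y = \<rho> x}. f y))"
proof -
  have "(\<Sum>x\<in>A. f x * (\<Sum>y\<in>{y\<in>A. \<rho> y = \<rho> x}. f y))
      = (\<Sum>z\<in>\<rho> ` A. \<Sum>x\<in>{x\<in>A. \<rho> x = z}. f x * (\<Sum>y\<in>{y\<in>A. \<rho> y = \<rho> x}. f y))"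
    by (rule sum.image_gen[OF assms])
  also have "\<dots> = (\<Sum>z\<in>\<rho> ` A. (\<Sum>x\<in>{x\<in>A. \<rho> x = z}. f x)\<^sup>2)"
    by (intro sum.cong refl) (simp add: power2_eq_square sum_distrib_right)
  also have "\<dots> \<ge> 0" by (intro sum_nonneg) auto
  finally show ?thesis .
qed

text \<open>The operator is the sum over fibres plus a diagonal with nonnegative entries coming from
  rejections; both parts are symmetric and positive semidefinite.\<close>

lemma
  fixes \<Omega> :: "('v \<Rightarrow> nat) set" and f g :: "('v \<Rightarrow> nat) \<Rightarrow> real"
  assumes fin: "finite \<Omega>" and q: "\<Omega> \<subseteq> {x. x v < q}"
  shows sum_recolour_sym: "(\<Sum>x\<in>\<Omega>. g x * (\<Sum>c<q. f (recolour \<Omega> x v c)))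
      = (\<Sum>x\<in>\<Omega>. f x * (\<Sum>c<q. g (recolour \<Omega> x v c)))" (is ?sym)
    and sum_recolour_nonneg: "0 \<le> (\<Sum>x\<in>\<Omega>. f x * (\<Sum>c<q. f (recolour \<Omega> x v c)))" (is ?nonneg)
proof -
  let ?\<rho> = "\<lambda>x::'v \<Rightarrow> nat. x(v := 0)"
  have eq: "(\<Sum>x\<in>\<Omega>. g x * (\<Sum>c<q. f (recolour \<Omega> x v c)))
    = (\<Sum>x\<in>\<Omega>. g x * (\<Sum>y\<in>{y\<in>\<Omega>. ?\<rho> y = ?\<rho> x}. f y))
      + (\<Sum>x\<in>\<Omega>. (real q - real (card {y\<in>\<Omega>. ?\<rho> y = ?\<rho> x})) * (g x * f x))" for f g :: "('v \<Rightarrow> nat) \<Rightarrow> real"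
    unfolding sum.distrib[symmetric]
    by (rule sum.cong[OF refl]) (simp add: sum_recolour_eq_sum_fibre[OF fin q] algebra_simps)
  show ?sym
    unfolding eq by (subst sum_fibre_sym) (simp add: mult.commute)
  \<comment> \<open>Within a fibre a configuration is determined by its colour at \<open>v\<close>,
    so the diagonal entries are not negative.\<close>
  have le: "card {y\<in>\<Omega>. ?\<rho> y = ?\<rho> x} \<le> q" if "x \<in> \<Omega>" for x
  proof -
    have "inj_on (\<lambda>y. y v) {y\<in>\<Omega>. ?\<rho> y = ?\<rho> x}"
      by (rule inj_onI) (metis (mono_tags, lifting) fun_upd_triv fun_upd_upd mem_Collect_eq)
    then have "card {y\<in>\<Omega>. ?\<rho> y = ?\<rho> x} \<le> card {..<q}"
      by (rule card_inj_on_le) (use q in auto)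
    then show ?thesis by simp
  qed
  show ?nonneg
    unfolding eq
    by (intro add_nonneg_nonneg sum_fibre_nonneg fin sum_nonneg mult_nonneg_nonneg[OF _ zero_le_square])
      (use le in simp)
qed

text \<open>A positive semidefinite operator \<open>P \<le> 1\<close> satisfies \<open>P\<^sup>2 \<le> P\<close>, so the spectral gap contracts
  the variance without any spectral decomposition.\<close>

lemma ssq_contraction:
  fixes P :: "('a \<Rightarrow> real) \<Rightarrow> 'a \<Rightarrow> real"
  assumes fin: "finite A"
    and lin: "\<And>f g c x. x \<in> A \<Longrightarrow> P (\<lambda>y. f y - c * g y) x = P f x - c * P g x"
    and one: "\<And>x. x \<in> A \<Longrightarrow> P (\<lambda>_. 1) x = 1"
    and selfadj: "\<And>f g. (\<Sum>x\<in>A. g x * P f x) = (\<Sum>x\<in>A. f x * P g x)"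
    and psd: "\<And>f. 0 \<le> (\<Sum>x\<in>A. f x * P f x)"
    and gap: "\<And>f. \<gamma> * ssq A f \<le> (\<Sum>x\<in>A. (f x)\<^sup>2) - (\<Sum>x\<in>A. f x * P f x)" and "\<gamma> \<ge> 0"
  shows "ssq A (P f) \<le> (1 - \<gamma>) * ssq A f"
    and "(\<Sum>x\<in>A. P f x) = (\<Sum>x\<in>A. f x)"
proof -
  have sumP: "(\<Sum>x\<in>A. P f x) = (\<Sum>x\<in>A. f x)" for f
    using selfadj[of "\<lambda>_. 1" f] one by simp
  then show "(\<Sum>x\<in>A. P f x) = (\<Sum>x\<in>A. f x)" .
  define m where "m = (\<Sum>x\<in>A. f x) / real (card A)"
  \<comment> \<open>Centring turns \<open>ssq\<close> into a plain sum of squares, and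
    \<open>P\<close> preserves the centring because it preserves sums.\<close>
  define h where "h x = f x - m" for x
  have "(\<Sum>x\<in>A. h x) = 0"
    by (cases "A = {}") (use fin in \<open>simp_all add: h_def m_def sum_subtractf\<close>)
  then have h0: "ssq A h = (\<Sum>x\<in>A. (h x)\<^sup>2)" "ssq A (P h) = (\<Sum>x\<in>A. (P h x)\<^sup>2)"
    by (simp_all add: ssq_def sumP)
  have Ph: "P h x = P f x - m" if "x \<in> A" for x
    using lin[OF that, of f m "\<lambda>_. 1"] one[OF that] by (simp add: h_def[abs_def])
  have "ssq A (P f) = ssq A (\<lambda>x. P f x - m)"
    by (simp add: ssq_diff_const[OF fin])
  also have "\<dots> = ssq A (P h)" by (simp add: ssq_def Ph cong: sum.cong)
  also have "\<dots> \<le> (\<Sum>x\<in>A. h x * P h x)"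
  proof -
    let ?u = "P h"
    \<comment> \<open>Positivity at \<open>h - P h\<close> reads
      \<open>P - 2 * P\<^sup>2 + P\<^sup>3 \<ge> 0\<close> as a quadratic form, and
      \<open>P \<le> 1\<close> bounds the cube by the square.\<close>
    have "0 \<le> (\<Sum>x\<in>A. (h x - 1 * ?u x) * P (\<lambda>y. h y - 1 * ?u y) x)" by (rule psd)
    also have "\<dots> = (\<Sum>x\<in>A. (h x - ?u x) * (P h x - P ?u x))"
      using lin[of _ h 1 ?u] by (intro sum.cong refl) simp
    also have "\<dots> = (\<Sum>x\<in>A. h x * P h x) - (\<Sum>x\<in>A. h x * P ?u x) - (\<Sum>x\<in>A. ?u x * P h x)
        + (\<Sum>x\<in>A. ?u x * P ?u x)"
      by (simp add: sum.distrib sum_subtractf algebra_simps)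
    also have "(\<Sum>x\<in>A. h x * P ?u x) = (\<Sum>x\<in>A. ?u x * P h x)" by (rule selfadj)
    \<comment> \<open>\<open>P \<le> 1\<close> is read off the gap hypothesis, whose left-hand side
      is nonnegative.\<close>
    also have "(\<Sum>x\<in>A. ?u x * P ?u x) \<le> (\<Sum>x\<in>A. (?u x)\<^sup>2)"
      using gap[of ?u] ssq_nonneg[OF fin, of ?u] \<open>\<gamma> \<ge> 0\<close> by (smt (verit) mult_nonneg_nonneg)
    finally show ?thesis by (simp add: h0 power2_eq_square)
  qed
  also have "\<dots> \<le> (1 - \<gamma>) * ssq A h"
    using gap[of h] by (simp add: h0 algebra_simps)
  also have "ssq A h = ssq A f" by (simp add: h_def[abs_def] ssq_diff_const[OF fin])
  finally show "ssq A (P f) \<le> (1 - \<gamma>) * ssq A f" .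
qed

section \<open>Iterated kernels and total variation\<close>

lemma expectation_finite_sum:
  fixes f :: "'a \<Rightarrow> real"
  assumes "finite A" "set_pmf p \<subseteq> A"
  shows "measure_pmf.expectation p f = (\<Sum>x\<in>A. pmf p x * f x)"
  using assms by (subst integral_measure_pmf[of A]) auto

lemma chain_dist_subset:
  assumes "\<And>x. x \<in> \<Omega> \<Longrightarrow> set_pmf (K x) \<subseteq> \<Omega>" "x \<in> \<Omega>"
  shows "set_pmf (chain_dist K t x) \<subseteq> \<Omega>"
proof (induction t)
  case (Suc t)
  then show ?case using assms(1) by (auto dest!: subsetD)
qed (use assms in simp)

text \<open>Duality between pushing a distribution forward and averaging an observable. The
  induction generalises \<open>f\<close> because the last step of the chain is absorbed into
  it.\<close>

lemma expectation_chain_dist: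
  fixes f :: "'s \<Rightarrow> real"
  assumes "finite \<Omega>" "\<And>x. x \<in> \<Omega> \<Longrightarrow> set_pmf (K x) \<subseteq> \<Omega>" "x \<in> \<Omega>"
  shows "measure_pmf.expectation (chain_dist K t x) f
    = ((\<lambda>g y. measure_pmf.expectation (K y) g) ^^ t) f x"
proof (induction t arbitrary: f)
  case (Suc t)
  define P where "P = (\<lambda>(g :: 's \<Rightarrow> real) y. measure_pmf.expectation (K y) g)"
  have IH: "measure_pmf.expectation (chain_dist K t x) f = (P ^^ t) f x" for f
    unfolding P_def by (rule Suc.IH)
  have sub: "set_pmf (chain_dist K t x) \<subseteq> \<Omega>" by (rule chain_dist_subset) (use assms in auto)
  have "measure_pmf.expectation (chain_dist K (Suc t) x) f
      = (\<Sum>y\<in>\<Omega>. pmf (chain_dist K t x) y *\<^sub>R measure_pmf.expectation (K y) f)"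
    unfolding chain_dist.simps
    by (rule pmf_expectation_bind) (use assms(1) sub finite_subset[OF assms(2)] in auto)
  also have "\<dots> = measure_pmf.expectation (chain_dist K t x) (P f)"
    by (simp add: expectation_finite_sum[OF assms(1) sub] P_def)
  also have "\<dots> = (P ^^ Suc t) f x"
    unfolding IH by (simp add: funpow_swap1)
  finally show ?case unfolding P_def .
qed simp

text \<open>The probability of an event after \<open>t\<close> steps is the iterated average of its
  indicator at \<open>x\<close>. The squared deviation from the mean is one term of an
  \<open>ssq\<close> that starts at most at \<open>card \<Omega>\<close> and shrinks by
  \<open>1 - \<gamma>\<close> per step.\<close>

lemma tv_dist_le_of_gap:
  fixes K :: "'s \<Rightarrow> 's pmf"
  defines "P \<equiv> \<lambda>f x. measure_pmf.expectation (K x) f"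
  assumes fin: "finite \<Omega>" and K: "\<And>x. x \<in> \<Omega> \<Longrightarrow> set_pmf (K x) \<subseteq> \<Omega>" and x: "x \<in> \<Omega>"
    and sym: "\<And>f g. (\<Sum>x\<in>\<Omega>. g x * P f x) = (\<Sum>x\<in>\<Omega>. f x * P g x)"
    and psd: "\<And>f. 0 \<le> (\<Sum>x\<in>\<Omega>. f x * P f x)"
    and gap: "\<And>f. \<gamma> * ssq \<Omega> f \<le> (\<Sum>x\<in>\<Omega>. (f x)\<^sup>2) - (\<Sum>x\<in>\<Omega>. f x * P f x)"
    and \<gamma>: "0 \<le> \<gamma>" "\<gamma> \<le> 1" and \<delta>: "\<delta> \<ge> 0" "real (card \<Omega>) * (1 - \<gamma>) ^ t \<le> \<delta>\<^sup>2"
  shows "tv_dist \<Omega> (chain_dist K t x) (pmf_of_set \<Omega>) \<le> \<delta>"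
proof -
  have Psum: "P f y = (\<Sum>z\<in>\<Omega>. pmf (K y) z * f z)" if "y \<in> \<Omega>" for f y
    unfolding P_def by (rule expectation_finite_sum[OF fin K[OF that]])
  have lin: "P (\<lambda>z. f z - c * g z) y = P f y - c * P g y" if "y \<in> \<Omega>" for f g c y
    using that by (simp add: Psum sum_subtractf sum_distrib_left algebra_simps)
  have one: "P (\<lambda>_. 1) y = 1" for y by (simp add: P_def)
  note contr = ssq_contraction[OF fin lin one sym psd gap \<gamma>(1)]
  have iter: "ssq \<Omega> ((P ^^ t) f) \<le> (1 - \<gamma>) ^ t * ssq \<Omega> f \<and> sum ((P ^^ t) f) \<Omega> = sum f \<Omega>" for f
  proof (induction t)
    case (Suc t)
    have "ssq \<Omega> (P ((P ^^ t) f)) \<le> (1 - \<gamma>) * ssq \<Omega> ((P ^^ t) f)" by (rule contr)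
    also have "\<dots> \<le> (1 - \<gamma>) * ((1 - \<gamma>) ^ t * ssq \<Omega> f)"
      using Suc \<gamma> by (intro mult_left_mono) auto
    finally show ?case using Suc contr(2) by simp
  qed simp
  have ne: "\<Omega> \<noteq> {}" using x by auto
  have "\<bar>measure_pmf.prob (chain_dist K t x) A - measure_pmf.prob (pmf_of_set \<Omega>) A\<bar> \<le> \<delta>"
    if A: "A \<subseteq> \<Omega>" for A
  proof -
    let ?f = "indicator A :: 's \<Rightarrow> real"
    let ?m = "sum ?f \<Omega> / real (card \<Omega>)"
    have sumf: "sum ?f \<Omega> = real (card A)"
      using A fin by (simp add: sum.inter_restrict[symmetric] indicator_def Int_absorb1 flip: of_bool_def)
    have 1: "measure_pmf.prob (chain_dist K t x) A = (P ^^ t) ?f x"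
      using expectation_chain_dist[OF fin K x, where t = t and f = ?f] by (simp add: P_def)
    have 2: "measure_pmf.prob (pmf_of_set \<Omega>) A = ?m"
      using A ne fin by (simp add: measure_pmf_of_set Int_absorb1 sumf)
    have "((P ^^ t) ?f x - ?m)\<^sup>2 \<le> (\<Sum>y\<in>\<Omega>. ((P ^^ t) ?f y - ?m)\<^sup>2)"
      by (rule member_le_sum) (use fin x in auto)
    \<comment> \<open>Iteration preserves the sum, so \<open>?m\<close> is still the mean.\<close>
    also have "\<dots> = ssq \<Omega> ((P ^^ t) ?f)"
      using ssq_eq_mean[OF fin, of "(P ^^ t) ?f"] iter[of ?f] by simp
    also have "\<dots> \<le> (1 - \<gamma>) ^ t * ssq \<Omega> ?f" using iter by blast
    also have "\<dots> \<le> (1 - \<gamma>) ^ t * real (card \<Omega>)"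
    proof (rule mult_left_mono)
      have "ssq \<Omega> ?f \<le> (\<Sum>y\<in>\<Omega>. (?f y - 0)\<^sup>2)" by (rule ssq_le_sum_diff_const[OF fin])
      also have "\<dots> \<le> (\<Sum>y\<in>\<Omega>. 1)" by (intro sum_mono) (simp add: indicator_def)
      finally show "ssq \<Omega> ?f \<le> real (card \<Omega>)" by simp
    qed (use \<gamma> in auto)
    also have "\<dots> \<le> \<delta>\<^sup>2" using \<delta>(2) by (simp add: mult.commute)
    finally have "\<bar>(P ^^ t) ?f x - ?m\<bar> \<le> \<bar>\<delta>\<bar>" by (simp only: abs_le_square_iff)
    then show ?thesis
      using \<delta>(1) by (simp add: 1 2)
  qed
  then show ?thesis
    unfolding tv_dist_def using fin by (subst Max_le_iff) auto
qed

section \<open>Mixing time of the Metropolis chain\<close>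

lemma mixing_time_le:
  assumes "finite \<Omega>" "\<Omega> \<noteq> {}" "T > 0"
    and "\<And>x t. x \<in> \<Omega> \<Longrightarrow> t \<ge> T \<Longrightarrow> tv_dist \<Omega> (chain_dist K t x) \<pi> \<le> \<delta>"
  shows "mixing_time K \<Omega> \<pi> \<delta> \<le> enat T"
  unfolding mixing_time_def mixing_time_from_def
  using assms by (subst Max_le_iff) (auto intro!: Inf_lower)

lemma
  fixes adj :: "'v \<Rightarrow> 'v \<Rightarrow> bool" and f :: "('v \<Rightarrow> nat) \<Rightarrow> real"
  defines "\<Omega> \<equiv> \<lambda>V q. proper_colourings V adj q"
  assumes V: "finite V" "V \<noteq> {}" and q: "q > 0"
  shows expectation_metropolis_step: "measure_pmf.expectation (metropolis_step V adj q x) f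
      = (\<Sum>v\<in>V. \<Sum>c<q. f (recolour (\<Omega> V q) x v c)) / (real (card V) * real q)"
    and metropolis_step_closed: "x \<in> \<Omega> V q \<Longrightarrow> set_pmf (metropolis_step V adj q x) \<subseteq> \<Omega> V q"
proof -
  have q': "{..<q} \<noteq> {}" using q by auto
  show "measure_pmf.expectation (metropolis_step V adj q x) f
      = (\<Sum>v\<in>V. \<Sum>c<q. f (recolour (\<Omega> V q) x v c)) / (real (card V) * real q)"
    unfolding metropolis_step_def recolour_def[symmetric]
    by (subst pmf_expectation_bind_pmf_of_set[OF V(2,1)], (use q' in simp),
        subst pmf_expectation_bind_pmf_of_set[OF q'])
      (auto simp: \<Omega>_def sum_distrib_left sum_divide_distrib field_simps recolour_def
        intro!: sum.cong)
  show "set_pmf (metropolis_step V adj q x) \<subseteq> \<Omega> V q" if "x \<in> \<Omega> V q"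
    using that V q' by (auto simp: metropolis_step_def \<Omega>_def split: if_splits)
qed

text \<open>The Poincare constant becomes the gap \<open>1 / (card V * q * C)\<close>, and bounding
  \<open>(1 - \<gamma>) ^ t\<close> by an exponential makes the required time logarithmic in the
  number of colourings.\<close>

lemma mixing_time_metropolis_le:
  fixes adj :: "'v \<Rightarrow> 'v \<Rightarrow> bool"
  defines "\<Omega> \<equiv> \<lambda>V q. proper_colourings V adj q"
  assumes V: "finite V" "V \<noteq> {}" and q: "q > 0" and ne: "\<Omega> V q \<noteq> {}"
    and P: "poincare q V (\<Omega> V q) C" and C: "C \<ge> 1" and \<delta>: "\<delta> > 0" and T: "T > 0"
    and T': "real (card V) * real q * C * ln (real (card (\<Omega> V q)) / \<delta>\<^sup>2) \<le> real T"
  shows "mixing_time (metropolis_step V adj q) (\<Omega> V q) (pmf_of_set (\<Omega> V q)) \<delta> \<le> enat T"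
proof (rule mixing_time_le)
  let ?\<Omega> = "\<Omega> V q" and ?K = "metropolis_step V adj q"
  define m where "m = real (card V) * real q"
  define \<gamma> where "\<gamma> = 1 / (m * C)"
  have "card V \<ge> 1" using V by (simp add: Suc_le_eq card_gt_0_iff)
  then have m: "m \<ge> 1" using q mult_mono[of 1 "real (card V)" 1 "real q"] by (simp add: m_def)
  \<comment> \<open>\<open>C \<ge> 1\<close> keeps the gap at most 1.\<close>
  have mC: "m * C \<ge> 1" using m C mult_mono[of 1 m 1 C] by simp
  show fin: "finite ?\<Omega>" unfolding \<Omega>_def by (rule finite_proper_colourings[OF V(1)])
  have cols: "?\<Omega> \<subseteq> {x. x v < q}" if "v \<in> V" for v
    using that by (auto simp: \<Omega>_def proper_colourings_def PiE_def Pi_def)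
  have E: "measure_pmf.expectation (?K x) f = (\<Sum>v\<in>V. \<Sum>c<q. f (recolour ?\<Omega> x v c)) / m" for x f
    unfolding m_def \<Omega>_def by (rule expectation_metropolis_step[OF V q])
  have form: "(\<Sum>x\<in>?\<Omega>. g x * measure_pmf.expectation (?K x) f)
      = (\<Sum>v\<in>V. \<Sum>x\<in>?\<Omega>. g x * (\<Sum>c<q. f (recolour ?\<Omega> x v c))) / m" for f g
    unfolding E by (subst sum.swap) (simp add: sum_distrib_left sum_divide_distrib)
  fix x t assume x: "x \<in> ?\<Omega>" and t: "t \<ge> T"
  show "tv_dist ?\<Omega> (chain_dist ?K t x) (pmf_of_set ?\<Omega>) \<le> \<delta>"
  proof (rule tv_dist_le_of_gap[OF fin _ x])
    show "set_pmf (?K x) \<subseteq> ?\<Omega>" if "x \<in> ?\<Omega>" for x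
      using that unfolding \<Omega>_def by (rule metropolis_step_closed[OF V q])
    show sym: "(\<Sum>x\<in>?\<Omega>. g x * measure_pmf.expectation (?K x) f)
        = (\<Sum>x\<in>?\<Omega>. f x * measure_pmf.expectation (?K x) g)" for f g :: "_ \<Rightarrow> real"
      unfolding form
      by (rule arg_cong[of _ _ "\<lambda>s. s / m"], rule sum.cong[OF refl], rule sum_recolour_sym[OF fin cols])
    show "0 \<le> (\<Sum>x\<in>?\<Omega>. f x * measure_pmf.expectation (?K x) f)" for f :: "_ \<Rightarrow> real"
      unfolding form using m
      by (intro divide_nonneg_nonneg sum_nonneg sum_recolour_nonneg[OF fin cols]) auto
    show "\<gamma> * ssq ?\<Omega> f \<le> (\<Sum>x\<in>?\<Omega>. (f x)\<^sup>2) - (\<Sum>x\<in>?\<Omega>. f x * measure_pmf.expectation (?K x) f)" for f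
    proof -
      \<comment> \<open>Each single-site operator preserves the uniform distribution: symmetry is
        tested against the constant 1.\<close>
      have sq: "(\<Sum>v\<in>V. \<Sum>x\<in>?\<Omega>. \<Sum>c<q. (f (recolour ?\<Omega> x v c))\<^sup>2) = m * (\<Sum>x\<in>?\<Omega>. (f x)\<^sup>2)"
      proof -
        have "(\<Sum>x\<in>?\<Omega>. \<Sum>c<q. (f (recolour ?\<Omega> x v c))\<^sup>2) = real q * (\<Sum>x\<in>?\<Omega>. (f x)\<^sup>2)" if "v \<in> V" for v
          using sum_recolour_sym[OF fin cols[OF that], of "\<lambda>_. 1" "\<lambda>x. (f x)\<^sup>2"]
          by (simp add: sum_distrib_left mult.commute)
        then show ?thesis by (simp add: m_def)
      qed
      have "energy q V ?\<Omega> f = (\<Sum>v\<in>V. \<Sum>x\<in>?\<Omega>. \<Sum>c<q.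
          (f x)\<^sup>2 - 2 * (f x * f (recolour ?\<Omega> x v c)) + (f (recolour ?\<Omega> x v c))\<^sup>2)"
        unfolding energy_def by (intro sum.cong refl) (simp add: power2_diff)
      also have "\<dots> = m * (\<Sum>x\<in>?\<Omega>. (f x)\<^sup>2)
          - 2 * (\<Sum>v\<in>V. \<Sum>x\<in>?\<Omega>. f x * (\<Sum>c<q. f (recolour ?\<Omega> x v c))) + m * (\<Sum>x\<in>?\<Omega>. (f x)\<^sup>2)"
        by (simp only: sum.distrib sum_subtractf sum_distrib_left[symmetric] sum_constant sq m_def
            card_lessThan mult.assoc) (simp only: mult.left_commute)
      also have "\<dots> = 2 * m * ((\<Sum>x\<in>?\<Omega>. (f x)\<^sup>2) - (\<Sum>x\<in>?\<Omega>. f x * measure_pmf.expectation (?K x) f))"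
        unfolding form using m by (simp add: field_simps)
      finally have "2 * ssq ?\<Omega> f \<le> C * (2 * m * ((\<Sum>x\<in>?\<Omega>. (f x)\<^sup>2) - (\<Sum>x\<in>?\<Omega>. f x * measure_pmf.expectation (?K x) f)))"
        using P unfolding poincare_def by metis
      then have "ssq ?\<Omega> f \<le> ((\<Sum>x\<in>?\<Omega>. (f x)\<^sup>2) - (\<Sum>x\<in>?\<Omega>. f x * measure_pmf.expectation (?K x) f)) * (m * C)"
        by (simp only: mult_ac mult_le_cancel_left_pos[OF zero_less_numeral] mult.left_commute[of C 2])
      then show ?thesis
        unfolding \<gamma>_def using mC by (simp only: times_divide_eq_left mult_1 pos_divide_le_eq[of "m * C"])
    qed
    show \<gamma>: "0 \<le> \<gamma>" "\<gamma> \<le> 1" using mC by (auto simp: \<gamma>_def)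
    show "\<delta> \<ge> 0" using \<delta> by simp
    let ?N = "real (card ?\<Omega>)"
    have N: "?N > 0" using ne fin by (simp add: card_gt_0_iff)
    have "m * C * ln (?N / \<delta>\<^sup>2) \<le> real t" using T' t by (simp add: m_def)
    then have "ln (?N / \<delta>\<^sup>2) \<le> \<gamma> * real t" using mC by (simp add: \<gamma>_def field_simps)
    then have "?N / \<delta>\<^sup>2 \<le> exp (\<gamma> * real t)"
      using N \<delta> by (metis divide_pos_pos exp_le_cancel_iff exp_ln zero_less_power)
    then have "?N * exp (- (\<gamma> * real t)) \<le> \<delta>\<^sup>2"
      using \<delta> by (simp add: exp_minus field_simps)
    moreover have "(1 - \<gamma>) ^ t \<le> exp (- (\<gamma> * real t))"
    proof -
      have "(1 - \<gamma>) ^ t \<le> exp (- \<gamma>) ^ t"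
        using \<gamma> exp_ge_add_one_self[of "- \<gamma>"] by (intro power_mono) auto
      then show ?thesis by (simp add: exp_of_nat_mult[symmetric] mult.commute)
    qed
    ultimately show "?N * (1 - \<gamma>) ^ t \<le> \<delta>\<^sup>2"
      using mult_left_mono[of "(1 - \<gamma>) ^ t" "exp (- (\<gamma> * real t))" ?N] by linarith
  qed
qed (use ne T in auto)

section \<open>Explicit constants for the tree\<close>

lemma card_proper_colourings_le: "finite V \<Longrightarrow> card (proper_colourings V adj q) \<le> q ^ card V"
  using card_mono[OF _ proper_colourings_subset, of V q adj]
  by (simp add: finite_PiE card_PiE)

lemma card_tree_verts_ge: "b ^ H \<le> card (tree_verts b H)"
proof -
  have "card {v. set v \<subseteq> {..<b} \<and> length v = H} \<le> card (tree_verts b H)"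
    by (rule card_mono[OF finite_tree_verts]) (auto simp: tree_verts_def)
  then show ?thesis by (simp add: card_lists_length_eq)
qed

text \<open>\<open>1 + 3 * 2 ^ b \<le> 8 ^ b \<le> exp (3 * b)\<close>, and
  \<open>exp (3 * b * H)\<close> is the stated power of the number \<open>b ^ H\<close> of leaves,
  because \<open>ln (b ^ H) = H * ln b\<close>.\<close>

lemma poincare_constant_le:
  assumes "b \<ge> 2"
  shows "(1 + 3 * 2 ^ b) ^ H \<le> real (card (tree_verts b H)) powr (3 * real b / ln (real b))"
proof -
  have b: "real b > 1" using assms by simp
  have "(4::real) ^ 2 \<le> 4 ^ b" using assms by (intro power_increasing) auto
  then have "2 ^ b * 16 \<le> 2 ^ b * (4::real) ^ b" by simp
  also have "\<dots> = 8 ^ b" by (simp flip: power_mult_distrib)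
  finally have "(1 + 3 * 2 ^ b :: real) \<le> 8 ^ b" using one_le_power[of "2::real" b] by linarith
  also have "(8::real) \<le> exp 3"
  proof -
    have "(2::real) ^ 3 \<le> exp 1 ^ 3" using exp_ge_add_one_self[of 1] by (intro power_mono) auto
    then show ?thesis by (simp flip: exp_of_nat_mult)
  qed
  then have "(8::real) ^ b \<le> exp 3 ^ b" by (intro power_mono) auto
  finally have "(1 + 3 * 2 ^ b :: real) ^ H \<le> (exp 3 ^ b) ^ H" by (intro power_mono) auto
  also have "\<dots> = real (b ^ H) powr (3 * real b / ln (real b))"
    using b by (simp add: powr_def ln_realpow exp_of_nat_mult[symmetric] mult_ac)
  also have "\<dots> \<le> real (card (tree_verts b H)) powr (3 * real b / ln (real b))"
    using card_tree_verts_ge[of b H] b by (intro powr_mono2) auto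
  finally show ?thesis .
qed

lemma tree_mixing_time_le:
  assumes b: "b \<ge> 2" and q: "q \<ge> 3" and n: "n = card (tree_verts b H)"
  shows "ereal_of_enat (tree_mixing_time b q H (1 / (2 * exp 1)))
    \<le> ereal (3 * real b * (real q)\<^sup>2 * (1 + log 2 (real n)) * real n powr (3 + 3 * real b / ln (real b)))"
proof -
  let ?V = "tree_verts b H"
  let ?\<Omega> = "proper_colourings ?V tree_adj q"
  let ?\<delta> = "1 / (2 * exp 1) :: real"
  define D where "D = (1 + 3 * 2 ^ b :: real) ^ H"
  define m where "m = real n * real q"
  \<comment> \<open>The bound of \<open>mixing_time_metropolis_le\<close>, rounded up, with
    \<open>m + 4\<close> in place of the logarithm.\<close>
  define T where "T = nat \<lceil>m * (3 / 2 * D) * (m + 4)\<rceil>"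
  have ne: "?V \<noteq> {}" using root_in_subtree[of "[]" b H] by (auto simp: subtree_Nil)
  then have n1: "n \<ge> 1" using n finite_tree_verts by (simp add: Suc_le_eq card_gt_0_iff)
  have m: "m \<ge> 3" using n1 q mult_mono[of 1 "real n" 3 "real q"] by (simp add: m_def)
  have D: "D \<ge> 1" unfolding D_def by (rule one_le_power) simp
  have \<Omega>: "?\<Omega> \<noteq> {}" using q by (intro proper_colourings_tree_nonempty) auto
  have "ln (real (card ?\<Omega>) / ?\<delta>\<^sup>2) \<le> m + 4"
  proof -
    have N: "card ?\<Omega> > 0"
      using \<Omega> finite_proper_colourings[OF finite_tree_verts] by (simp add: card_gt_0_iff)
    have "real (card ?\<Omega>) \<le> real (q ^ n)"
      unfolding n by (intro of_nat_mono card_proper_colourings_le finite_tree_verts)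
    \<comment> \<open>The crude bound \<open>q \<le> exp q\<close> yields \<open>n * q\<close>
      instead of \<open>n * ln q\<close>, which the factor \<open>q\<^sup>2\<close> of the target
      affords.\<close>
    also have "\<dots> \<le> exp (real q) ^ n"
      using exp_ge_add_one_self[of "real q"] unfolding of_nat_power by (intro power_mono) linarith+
    also have "\<dots> = exp m" by (simp add: m_def exp_of_nat_mult)
    finally have 1: "real (card ?\<Omega>) \<le> exp m" .
    have "(2 * exp 1 :: real) ^ 2 \<le> (exp 1 * exp 1) ^ 2"
      using exp_ge_add_one_self[of 1] by (intro power_mono mult_right_mono) auto
    also have "\<dots> = exp 4" by (simp flip: exp_of_nat_mult exp_add)
    finally have "real (card ?\<Omega>) / ?\<delta>\<^sup>2 \<le> exp m * exp 4"
      using 1 by (simp add: power_divide mult_mono)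
    then have "ln (real (card ?\<Omega>) / ?\<delta>\<^sup>2) \<le> ln (exp m * exp 4)"
      using N by (subst ln_le_cancel_iff) (simp_all add: zero_less_divide_iff)
    also have "\<dots> = m + 4" by (simp flip: exp_add)
    finally show ?thesis .
  qed
  then have "m * (3 / 2 * D) * ln (real (card ?\<Omega>) / ?\<delta>\<^sup>2) \<le> m * (3 / 2 * D) * (m + 4)"
    using m D by (intro mult_left_mono) auto
  also have "\<dots> \<le> real T" unfolding T_def by (rule real_nat_ceiling_ge)
  finally have T': "m * (3 / 2 * D) * ln (real (card ?\<Omega>) / ?\<delta>\<^sup>2) \<le> real T" .
  have pos: "m * (3 / 2 * D) * (m + 4) > 0" using m D by simp
  have "tree_mixing_time b q H ?\<delta> \<le> enat T"
    unfolding tree_mixing_time_def Let_def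
  proof (rule mixing_time_metropolis_le[where C = "3 / 2 * D"])
    show "poincare q ?V ?\<Omega> (3 / 2 * D)" unfolding D_def by (rule poincare_tree[OF q])
  qed (use finite_tree_verts ne q \<Omega> D T' pos in \<open>auto simp: T_def m_def n\<close>)
  then have "ereal_of_enat (tree_mixing_time b q H ?\<delta>) \<le> ereal_of_enat (enat T)"
    by (subst ereal_of_enat_le_iff)
  also have "\<dots> = ereal (real T)" by simp
  also have "real T \<le> 3 * real b * (real q)\<^sup>2 * (1 + log 2 (real n)) * real n powr (3 + 3 * real b / ln (real b))"
  proof -
    have "real T \<le> m * (3 / 2 * D) * (m + 4) + 1"
      unfolding T_def using pos by linarith
    \<comment> \<open>\<open>m \<ge> 3\<close> and \<open>D \<ge> 1\<close> absorb the linear term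
      and the 1 lost in rounding.\<close>
    also have "\<dots> \<le> 6 * m\<^sup>2 * D"
    proof -
      have "m * (3 / 2 * D) * (m + 4) + 1 = 3 / 2 * (m * (m * D)) + 6 * (m * D) + 1"
        by algebra
      moreover have "6 * m\<^sup>2 * D = 6 * (m * (m * D))" by algebra
      moreover have "3 * (m * D) \<le> m * (m * D)" using m D by (intro mult_right_mono) auto
      moreover have "1 \<le> m * D" using m D mult_mono[of 1 m 1 D] by simp
      ultimately show ?thesis by linarith
    qed
    also have "\<dots> = 3 * 2 * (real q)\<^sup>2 * 1 * ((real n)\<^sup>2 * D)"
      by (simp add: m_def power_mult_distrib)
    \<comment> \<open>The slack is spent on \<open>2 \<le> b\<close>,
      \<open>1 \<le> 1 + log 2 n\<close> and the passage from \<open>n ^ 2\<close> to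
      \<open>n ^ 3\<close>.\<close>
    also have "\<dots> \<le> 3 * real b * (real q)\<^sup>2 * (1 + log 2 (real n))
        * (real n ^ 3 * real n powr (3 * real b / ln (real b)))"
      using b q n1 D poincare_constant_le[OF b, of H] n
      by (intro mult_mono power_increasing) (auto simp: D_def)
    also have "real n ^ 3 * real n powr (3 * real b / ln (real b)) = real n powr (3 + 3 * real b / ln (real b))"
      using n1 by (simp add: powr_add)
    finally show ?thesis .
  qed
  finally show ?thesis by simp
qed

theorem theorem1:
  "(\<exists>C::real. C > 0 \<and>
      (\<forall>b q :: nat. b \<ge> 2 \<longrightarrow> q \<ge> 3 \<longrightarrow>
        (\<forall>\<^sub>F H in sequentially.
          ereal_of_enat (tree_mixing_time b q H (1 / (2 * exp 1)))
            \<le> ereal (real (card (tree_verts b H)) powr (C * (real b / ln (real b)))))))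
   \<and> (\<forall>b q H n :: nat. b \<ge> 2 \<longrightarrow> q \<ge> 3 \<longrightarrow> n = card (tree_verts b H) \<longrightarrow>
        ereal_of_enat (tree_mixing_time b q H (1 / (2 * exp 1)))
          \<le> ereal (3 * real b * (real q)\<^sup>2 * (1 + log 2 (real n))
                    * real n powr (3 + 3 * real b / ln (real b))))"
proof (intro conjI exI[of _ 8] allI impI)
  fix b q :: nat assume b: "b \<ge> 2" and q: "q \<ge> 3"
  show "\<forall>\<^sub>F H in sequentially.
          ereal_of_enat (tree_mixing_time b q H (1 / (2 * exp 1)))
            \<le> ereal (real (card (tree_verts b H)) powr (8 * (real b / ln (real b))))"
    \<comment> \<open>Since \<open>n > H\<close>, from this height on the prefactor in
      \<open>b\<close> and \<open>q\<close> is at most one power of \<open>n\<close>.\<close>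
    using eventually_ge_at_top[of "3 * b * q\<^sup>2"]
  proof eventually_elim
    case (elim H)
    define n where "n = card (tree_verts b H)"
    define \<beta> where "\<beta> = real b / ln (real b)"
    have "ln (real b) > 0" "ln (real b) \<le> real b" using b ln_bound[of "real b"] by auto
    then have \<beta>: "\<beta> \<ge> 1" by (simp add: \<beta>_def)
    have "H < b ^ H" using b by (intro power_gt_expt) auto
    then have nH: "H < n" using card_tree_verts_ge[of b H] by (simp add: n_def)
    then have n: "3 * b * q\<^sup>2 \<le> n" "n \<ge> 1" using elim by auto
    \<comment> \<open>This makes the logarithmic factor cost at most one further power of
      \<open>n\<close>.\<close>
    have "n \<le> 2 ^ (n - 1)"
      using less_exp[of "n - 1"] n(2) by linarith
    then have "real n \<le> 2 ^ (n - 1)" by (metis of_nat_le_iff of_nat_numeral of_nat_power)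
    then have "real n \<le> 2 powr real (n - 1)" by (subst powr_realpow) simp_all
    then have "log 2 (real n) \<le> real (n - 1)" using n(2) by (subst log_le_iff) simp_all
    then have log: "1 + log 2 (real n) \<le> real n" using n(2) by (simp add: of_nat_diff)
    have "3 * real b * (real q)\<^sup>2 * (1 + log 2 (real n)) * real n powr (3 + 3 * \<beta>)
        \<le> real n * real n * real n powr (3 + 3 * \<beta>)"
    proof (intro mult_right_mono mult_mono log)
      have "real (3 * b * q\<^sup>2) \<le> real n" using n(1) by (rule of_nat_mono)
      then show "3 * real b * (real q)\<^sup>2 \<le> real n" by simp
    qed (use n(2) in auto)
    also have "\<dots> = real n powr (5 + 3 * \<beta>)"
      using n(2) powr_add[of "real n" 2 "3 + 3 * \<beta>"] by (simp add: power2_eq_square)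
    \<comment> \<open>\<open>\<beta> \<ge> 1\<close> turns the 5 into \<open>5 * \<beta>\<close>,
      which explains the constant 8.\<close>
    also have "\<dots> \<le> real n powr (8 * \<beta>)" using \<beta> n(2) by (intro powr_mono) auto
    finally show ?case
      using tree_mixing_time_le[OF b q n_def] by (auto simp: \<beta>_def n_def intro: order_trans)
  qed
qed (use tree_mixing_time_le in auto)

end
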